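(* Let $G=S(\mathbb{N})$ be the Polish topological group of all permutations of $\mathbb{N}$ with the topology of pointwise convergence, and let $X^*=\mathbb{N}\cup\{\infty\}$ be the one point compactification of the discrete space $\mathbb{N}$ with the natural action of $G$ (fixing $\infty$). (1) The two algebras $\mathrm{UC}(G)$ and $\mathrm{WAP}(G)$ coincide. (2) The universal WAP compactification $G^{\mathrm{WAP}}$ of $G$ (and hence also $G^{\mathrm{UC}}$) is isomorphic to the enveloping semigroup $E=E(G,X^* )$. Thus the universal WAP (and Roelcke) compactification of $G$ is homeomorphic to the Cantor set.
   Context: For a topological group $G$, all functions are bounded real valued. $\mathrm{UC}(G)$ is the algebra of bounded continuous $f\colon G\to\mathbb{R}$ that are both right and left uniformly continuous: for every $\varepsilon>0$ there is a neighborhood $V$ of $e$ with $\sup_{g\in G}|f(vg)-f(g)|<\varepsilon$ and $\sup_{g\in G}|f(gv)-f(g)|<\varepsilon$ for all $v\in V$. $\mathrm{WAP}(G)$ is the algebra of bounded continuous $f\colon G\to\mathbb{R}$ whose orbit $\{fg\}_{g\in G}$, $(fg)(x)=f(gx)$, is relatively weakly compact in the Banach space $C(G)$ of bounded continuous functions. $G^{\mathrm{UC}}$ (the Roelcke compactification) and $G^{\mathrm{WAP}}$ (the universal WAP compactification) are the Gelfand spaces of these algebras, which are compact $G$-spaces with a canonical $G$-map from $G$ (with the left translation action) sending $g$ to evaluation at $g$. The enveloping semigroup $E(G,X)$ of a compact $G$-space $X$ is the closure in $X^X$ (product topology) of the set of translations $\pi^g\colon x\mapsto gx$, $g\in G$;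 it is a semigroup under composition, a compact $G$-space with action $(gp)(x)=g\,p(x)$, and receives the canonical $G$-map $G\to E(G,X)$, $g\mapsto\pi^g$. "Isomorphic" means isomorphic as compact $G$-spaces. *)

theory Defs
  imports "HOL-Analysis.Analysis"
begin

text \<open>
  Topological groups are rendered by the library class \<open>topological_group_add\<close>. This class does
  not assume commutativity; so \<open>g + h\<close>, \<open>0\<close> and \<open>- g\<close> are the product, the unit \<open>e\<close> and the
  inverse of a possibly non-abelian group. \<open>C(G)\<close> is the type \<open>'g \<Rightarrow>\<^sub>C real\<close> of bounded continuous
  functions with the supremum norm.
\<close>

section \<open>The algebras \<open>UC(G)\<close> and \<open>WAP(G)\<close>\<close>

definition UC :: "('g::topological_group_add \<Rightarrow>\<^sub>C real) set" where
  "UC = {f. \<forall>\<epsilon>>0. \<exists>V. open V \<and> 0 \<in> V \<and>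
          (\<forall>v\<in>V. (SUP g. \<bar>apply_bcontfun f (v + g) - apply_bcontfun f g\<bar>) < \<epsilon> \<and>
                 (SUP g. \<bar>apply_bcontfun f (g + v) - apply_bcontfun f g\<bar>) < \<epsilon>)}"

lemma translate_bcontfun:
  fixes f :: "'g::topological_group_add \<Rightarrow> real"
  assumes "f \<in> bcontfun"
  shows "(\<lambda>x. f (g + x)) \<in> bcontfun"
proof -
  have f: "continuous_on UNIV f" "bounded (range f)"
    using assms by (auto simp: bcontfun_def)
  have "continuous_on UNIV (\<lambda>x. f (g + x))"
    by (rule continuous_on_compose2[OF f(1)]) (auto intro!: continuous_intros)
  moreover have "bounded (range (\<lambda>x. f (g + x)))"
    by (rule bounded_subset[OF f(2)]) auto
  ultimately show ?thesis
    by (simp add: bcontfun_def)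
qed

text \<open>The function \<open>fg\<close>, with \<open>(fg)(x) = f(gx)\<close>.\<close>

unbundle bcontfun.lifting

lift_definition translate :: "('g::topological_group_add \<Rightarrow>\<^sub>C real) \<Rightarrow> 'g \<Rightarrow> ('g \<Rightarrow>\<^sub>C real)"
  is "\<lambda>f g x. f (g + x)"
  by (rule translate_bcontfun)

text \<open>The coarsest topology making all bounded linear functionals continuous.\<close>

definition weak_topology :: "'a::real_normed_vector topology" where
  "weak_topology = pullback_topology UNIV (\<lambda>x (\<phi> :: 'a \<Rightarrow>\<^sub>L real). blinfun_apply \<phi> x)
     (product_topology (\<lambda>_. euclideanreal) UNIV)"

definition relatively_weakly_compact :: "'a::real_normed_vector set \<Rightarrow> bool" where
  "relatively_weakly_compact S \<longleftrightarrow> compactin weak_topology (weak_topology closure_of S)"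

definition WAP :: "('g::topological_group_add \<Rightarrow>\<^sub>C real) set" where
  "WAP = {f. relatively_weakly_compact (range (translate f))}"

section \<open>Compact \<open>G\<close>-spaces\<close>

definition compact_G_space ::
    "'x topology \<Rightarrow> ('g::topological_group_add \<Rightarrow> 'x \<Rightarrow> 'x) \<Rightarrow> bool" where
  "compact_G_space X act \<longleftrightarrow>
     compact_space X \<and> Hausdorff_space X \<and>
     continuous_map (prod_topology euclidean X) X (\<lambda>(g, x). act g x) \<and>
     (\<forall>x\<in>topspace X. act 0 x = x) \<and>
     (\<forall>g h. \<forall>x\<in>topspace X. act (g + h) x = act g (act h x))"

definition isomorphic_compact_G_spaces ::
    "'x topology \<Rightarrow> ('g::topological_group_add \<Rightarrow> 'x \<Rightarrow> 'x) \<Rightarrow>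
     'y topology \<Rightarrow> ('g \<Rightarrow> 'y \<Rightarrow> 'y) \<Rightarrow> bool" where
  "isomorphic_compact_G_spaces X act Y act' \<longleftrightarrow>
     compact_G_space X act \<and> compact_G_space Y act' \<and>
     (\<exists>\<Phi>. homeomorphic_map X Y \<Phi> \<and> (\<forall>g. \<forall>x\<in>topspace X. \<Phi> (act g x) = act' g (\<Phi> x)))"

section \<open>Gelfand spaces\<close>

lemma times_bcontfun:
  fixes f g :: "'g::topological_space \<Rightarrow> real"
  assumes "f \<in> bcontfun" "g \<in> bcontfun"
  shows "(\<lambda>x. f x * g x) \<in> bcontfun"
proof -
  obtain B C where B: "\<And>x. \<bar>f x\<bar> \<le> B" and C: "\<And>x. \<bar>g x\<bar> \<le> C"
    using assms by (auto simp: bcontfun_def bounded_iff)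
  show ?thesis
  proof (rule bcontfun_normI)
    show "continuous_on UNIV (\<lambda>x. f x * g x)"
      using assms by (auto simp: bcontfun_def intro!: continuous_intros)
    show "norm (f x * g x) \<le> B * C" for x
      using mult_mono[OF B[of x] C[of x]] order_trans[OF abs_ge_zero B[of x]]
      by (simp add: abs_mult)
  qed
qed

lift_definition bcontfun_times ::
    "('g::topological_space \<Rightarrow>\<^sub>C real) \<Rightarrow> ('g \<Rightarrow>\<^sub>C real) \<Rightarrow> ('g \<Rightarrow>\<^sub>C real)"
  is "\<lambda>f g x. f x * g x"
  by (rule times_bcontfun)

text \<open>
  The nonzero multiplicative linear functionals on an algebra \<open>A\<close>. As usual for \<open>product_topology\<close>,
  functions on \<open>A\<close> are represented by elements of \<open>extensional A\<close>.
\<close>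

definition characters :: "('g::topological_space \<Rightarrow>\<^sub>C real) set \<Rightarrow> (('g \<Rightarrow>\<^sub>C real) \<Rightarrow> real) set" where
  "characters A = {\<phi> \<in> extensional A.
     (\<forall>f\<in>A. \<forall>g\<in>A. \<phi> (f + g) = \<phi> f + \<phi> g) \<and>
     (\<forall>c. \<forall>f\<in>A. \<phi> (c *\<^sub>R f) = c * \<phi> f) \<and>
     (\<forall>f\<in>A. \<forall>g\<in>A. \<phi> (bcontfun_times f g) = \<phi> f * \<phi> g) \<and>
     (\<exists>f\<in>A. \<phi> f \<noteq> 0)}"

definition gelfand_space ::
    "('g::topological_space \<Rightarrow>\<^sub>C real) set \<Rightarrow> (('g \<Rightarrow>\<^sub>C real) \<Rightarrow> real) topology" where
  "gelfand_space A = subtopology (product_topology (\<lambda>_. euclideanreal) A) (characters A)"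

text \<open>
  \<open>(g \<phi>)(f) = \<phi>(fg)\<close>. This is the action for which \<open>h \<mapsto> (evaluation at h)\<close> is a \<open>G\<close>-map for left
  translation on \<open>G\<close>: \<open>g\<close> applied to evaluation at \<open>h\<close> sends \<open>f\<close> to \<open>(fg)(h) = f(gh)\<close>.
\<close>

definition gelfand_action ::
    "('g::topological_group_add \<Rightarrow>\<^sub>C real) set \<Rightarrow> 'g \<Rightarrow> (('g \<Rightarrow>\<^sub>C real) \<Rightarrow> real) \<Rightarrow> ('g \<Rightarrow>\<^sub>C real) \<Rightarrow> real" where
  "gelfand_action A g \<phi> = (\<lambda>f\<in>A. \<phi> (translate f g))"

section \<open>Enveloping semigroups\<close>

definition enveloping_semigroup :: "'x topology \<Rightarrow> ('g \<Rightarrow> 'x \<Rightarrow> 'x) \<Rightarrow> ('x \<Rightarrow> 'x) topology" where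
  "enveloping_semigroup X act =
     (let P = product_topology (\<lambda>_. X) (topspace X)
      in subtopology P (P closure_of range (\<lambda>g. restrict (act g) (topspace X))))"

definition enveloping_action :: "'x topology \<Rightarrow> ('g \<Rightarrow> 'x \<Rightarrow> 'x) \<Rightarrow> 'g \<Rightarrow> ('x \<Rightarrow> 'x) \<Rightarrow> 'x \<Rightarrow> 'x" where
  "enveloping_action X act g p = (\<lambda>x\<in>topspace X. act g (p x))"

section \<open>The group \<open>S(\<nat>)\<close>\<close>

typedef nat_perm = "{\<pi> :: nat \<Rightarrow> nat. bij \<pi>}"
  morphisms perm_apply Abs_nat_perm
  by (rule exI[of _ id]) simp

setup_lifting type_definition_nat_perm

lemma bij_perm_apply [simp]: "bij (perm_apply g)"
  using perm_apply[of g] by simp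

instantiation nat_perm :: group_add
begin

lift_definition plus_nat_perm :: "nat_perm \<Rightarrow> nat_perm \<Rightarrow> nat_perm" is "\<lambda>g h. g \<circ> h"
  by (simp add: bij_comp)

lift_definition zero_nat_perm :: nat_perm is id
  by simp

lift_definition uminus_nat_perm :: "nat_perm \<Rightarrow> nat_perm" is inv
  by (simp add: bij_imp_bij_inv)

definition minus_nat_perm :: "nat_perm \<Rightarrow> nat_perm \<Rightarrow> nat_perm" where
  "minus_nat_perm g h = g + - h"

instance
proof
  fix a b c :: nat_perm
  show "a + b + c = a + (b + c)" by transfer (simp add: comp_assoc)
  show "0 + a = a" by transfer simp
  show "a + 0 = a" by transfer simp
  show "- a + a = 0" by transfer (simp add: bij_is_inj)
  show "a + - b = a - b" by (simp add: minus_nat_perm_def)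
qed

end

text \<open>
  The topology of pointwise convergence: the one induced by the product topology on
  \<open>nat \<Rightarrow> nat\<close>, with \<open>nat\<close> discrete.
\<close>

instantiation nat_perm :: topological_space
begin

definition open_nat_perm :: "nat_perm set \<Rightarrow> bool" where
  "open_nat_perm U \<longleftrightarrow> (\<exists>V. open V \<and> U = perm_apply -` V)"

instance
proof
  show "open (UNIV :: nat_perm set)"
    unfolding open_nat_perm_def by (rule exI[of _ UNIV]) auto
next
  fix S T :: "nat_perm set"
  assume "open S" "open T"
  then obtain V W where "open V" "S = perm_apply -` V" "open W" "T = perm_apply -` W"
    unfolding open_nat_perm_def by auto
  then show "open (S \<inter> T)"
    unfolding open_nat_perm_def by (intro exI[of _ "V \<inter> W"]) auto
next
  fix K :: "nat_perm set set"
  assume "\<forall>S\<in>K. open S"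
  then have "\<forall>S\<in>K. \<exists>V. open V \<and> S = perm_apply -` V"
    unfolding open_nat_perm_def by auto
  then obtain V where V: "\<And>S. S \<in> K \<Longrightarrow> open (V S) \<and> S = perm_apply -` V S"
    by metis
  then have "\<Union>K = perm_apply -` (\<Union>S\<in>K. V S)"
    by blast
  moreover have "open (\<Union>S\<in>K. V S)"
    using V by (intro open_UN) blast
  ultimately show "open (\<Union>K)"
    unfolding open_nat_perm_def by blast
qed

end

lemma tendsto_nat_perm_iff:
  "(f \<longlongrightarrow> p) F \<longleftrightarrow> (\<forall>n. \<forall>\<^sub>F x in F. perm_apply (f x) n = perm_apply p n)"
proof -
  have "(f \<longlongrightarrow> p) F \<longleftrightarrow> ((\<lambda>x. perm_apply (f x)) \<longlongrightarrow> perm_apply p) F"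
    unfolding tendsto_def open_nat_perm_def by auto
  also have "\<dots> \<longleftrightarrow> limitin (product_topology (\<lambda>_. euclidean) UNIV)
      (\<lambda>x. perm_apply (f x)) (perm_apply p) F"
    by (simp only: euclidean_product_topology limitin_canonical_iff)
  also have "\<dots> \<longleftrightarrow> (\<forall>n. ((\<lambda>x. perm_apply (f x) n) \<longlongrightarrow> perm_apply p n) F)"
    by (simp add: limitin_componentwise)
  also have "\<dots> \<longleftrightarrow> (\<forall>n. \<forall>\<^sub>F x in F. perm_apply (f x) n = perm_apply p n)"
    by (simp add: tendsto_discrete)
  finally show ?thesis .
qed

instance nat_perm :: topological_group_add
proof
  fix a b :: nat_perm
  have nb: "\<forall>\<^sub>F x in nhds c. perm_apply x n = perm_apply c n" for c n
    using tendsto_nat_perm_iff[of "\<lambda>x. x" c "nhds c"] by (simp add: filterlim_ident)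
  show "LIM x (nhds a \<times>\<^sub>F nhds b). fst x + snd x :> nhds (a + b)"
    unfolding tendsto_nat_perm_iff
  proof
    fix n
    have "\<forall>\<^sub>F x in nhds a \<times>\<^sub>F nhds b.
        perm_apply (fst x) (perm_apply b n) = perm_apply a (perm_apply b n)
        \<and> perm_apply (snd x) n = perm_apply b n"
      using nb[of "perm_apply b n" a] nb[of n b] unfolding eventually_prod_filter by fastforce
    then show "\<forall>\<^sub>F x in nhds a \<times>\<^sub>F nhds b. perm_apply (fst x + snd x) n = perm_apply (a + b) n"
      by eventually_elim (simp add: plus_nat_perm.rep_eq)
  qed
  show "(uminus \<longlongrightarrow> - a) (nhds a)"
    unfolding tendsto_nat_perm_iff
  proof
    fix n
    show "\<forall>\<^sub>F x in nhds a. perm_apply (- x) n = perm_apply (- a) n"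
      using nb[of "inv (perm_apply a) n" a]
    proof eventually_elim
      case (elim x)
      then have "perm_apply x (inv (perm_apply a) n) = n"
        by (simp add: bij_is_surj surj_f_inv_f)
      then have "inv (perm_apply x) n = inv (perm_apply a) n"
        by (metis bij_inv_eq_iff bij_perm_apply)
      then show ?case
        by (simp add: uminus_nat_perm.rep_eq)
    qed
  qed
qed

text \<open>The one point compactification \<open>X\<^sup>*\<close> of the discrete space \<open>\<nat>\<close>; \<open>None\<close> is the point \<open>\<infinity>\<close>.\<close>

definition X_star :: "nat option topology" where
  "X_star = Alexandroff_compactification (discrete_topology UNIV)"

definition X_star_action :: "nat_perm \<Rightarrow> nat option \<Rightarrow> nat option" where
  "X_star_action g = map_option (perm_apply g)"

section \<open>The Cantor set\<close>

primrec cantor_stage :: "nat \<Rightarrow> real set" where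
  "cantor_stage 0 = {0..1}"
| "cantor_stage (Suc n) = (\<lambda>x. x / 3) ` cantor_stage n \<union> (\<lambda>x. 2 / 3 + x / 3) ` cantor_stage n"

definition cantor_set :: "real set" where
  "cantor_set = (\<Inter>n. cantor_stage n)"

end

theory Submission
  imports Defs
begin

text \<open>
  Identify a permutation \<open>g\<close> with its 0-1 matrix, with entry \<open>(i, j)\<close> equal to \<open>1\<close> iff \<open>g(i) = j\<close>.
  Two permutations lie in the same double coset of the pointwise stabilizer of \<open>{0, \<dots>, n - 1}\<close> iff
  the upper left \<open>n \<times> n\<close> blocks of their matrices agree. Hence \<open>UC(G)\<close> consists of the functions that
  extend continuously to the closure \<open>K\<close> of the set of permutation matrices. So \<open>K\<close> is the Gelfand
  space of \<open>UC(G)\<close>; it is also \<open>E(G, X\<^sup>*)\<close>, by reading a map of \<open>X\<^sup>*\<close> as a matrix, and it is perfect,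
  hence a Cantor set.

  If \<open>F\<close> is a monomial in the matrix entries, the translates of \<open>F\<close> by the elements of \<open>K\<close> are \<open>0\<close> or
  indicator functions of disjoint sets. Such functions tend weakly to \<open>0\<close>, so \<open>p \<mapsto> F(p \<cdot>)\<close> is weakly
  continuous on \<open>K\<close>. By the Stone-Weierstrass theorem this carries over to all continuous \<open>F\<close>, and
  \<open>UC(G) \<subseteq> WAP(G)\<close>. The converse inclusion holds for all separable Baire groups: a pointwise compact
  set of continuous functions has small oscillation on some nonempty open set, and this is applied to
  the weak closure of the orbit of \<open>f\<close> and to the functions \<open>x \<mapsto> \<delta>(fx)\<close> for \<open>\<delta>\<close> in the dual unit ball.
\<close>

section \<open>Products of discrete spaces\<close>

text \<open>The obstacle for \<open>WAP\<close> is that a bounded functional on \<open>C(G)\<close>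
  need not be built from point evaluations, so pointwise continuity of
  \<open>p \<mapsto> F(p \<cdot>)\<close> does not give weak continuity. Disjointness does: a
  combination with coefficients of absolute value at most 1 of indicators of disjoint sets has norm
  at most 1, so the values of a functional on them are absolutely summable. This matters at matrices
  with a zero column. Such matrices occur in \<open>K\<close>, since preimages of a fixed point may
  run off to infinity; near such a matrix, finitely many entries can be kept at 0, and these exclude
  all indicators on which the functional is large.

  Square blocks, rather than full rows, appear because the condition in \<open>UC\<close> is
  two-sided: a small factor may be absorbed on either side, hence double cosets. A zero row of a
  matrix in \<open>K\<close> means that the point is sent to infinity; this is how maps of
  \<open>X\<^sup>*\<close> are read off.\<close>

lemma open_cylinder:
  fixes x :: "'i \<Rightarrow> 'b::discrete_topology"
  assumes "finite I"
  shows "open {y. \<forall>i\<in>I. y i = x i}"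
proof -
  have "{y. \<forall>i\<in>I. y i = x i} = (\<Inter>i\<in>I. (\<lambda>y. y i) -` {x i})"
    by auto
  moreover have "open ((\<lambda>y::'i \<Rightarrow> 'b. y i) -` {x i})" for i
    by (intro open_vimage open_discrete continuous_on_product_coordinates)
  ultimately show ?thesis
    using assms by (simp add: open_INT)
qed

lemma open_contains_cylinder:
  fixes x :: "'i \<Rightarrow> 'b::topological_space"
  assumes "open U" "x \<in> U"
  obtains I where "finite I" "\<And>y. (\<And>i. i \<in> I \<Longrightarrow> y i = x i) \<Longrightarrow> y \<in> U"
proof -
  have "openin (product_topology (\<lambda>_. euclidean) UNIV) U"
    using assms(1) by (simp add: euclidean_product_topology)
  then obtain X where X: "x \<in> Pi\<^sub>E UNIV X" "finite {i. X i \<noteq> UNIV}" "Pi\<^sub>E UNIV X \<subseteq> U"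
    using product_topology_open_contains_basis[of "\<lambda>_. euclidean" UNIV U x] assms(2) by auto
  show thesis
  proof
    show "finite {i. X i \<noteq> UNIV}"
      by (rule X(2))
    show "y \<in> U" if "\<And>i. i \<in> {i. X i \<noteq> UNIV} \<Longrightarrow> y i = x i" for y
    proof -
      have "y i \<in> X i" for i
        using X(1) that[of i] by (cases "X i = UNIV") auto
      then show ?thesis
        using X(3) by auto
    qed
  qed
qed

lemma continuous_on_cylinderI:
  fixes f :: "('i \<Rightarrow> 'b::discrete_topology) \<Rightarrow> 'c::topological_space"
  assumes "\<And>x U. x \<in> S \<Longrightarrow> open U \<Longrightarrow> f x \<in> U \<Longrightarrow>
    \<exists>I. finite I \<and> (\<forall>y\<in>S. (\<forall>i\<in>I. y i = x i) \<longrightarrow> f y \<in> U)"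
  shows "continuous_on S f"
  unfolding continuous_on_topological
proof (intro ballI allI impI)
  fix x U
  assume "x \<in> S" "open U" "f x \<in> U"
  then obtain I where "finite I" "\<forall>y\<in>S. (\<forall>i\<in>I. y i = x i) \<longrightarrow> f y \<in> U"
    using assms by blast
  then show "\<exists>A. open A \<and> x \<in> A \<and> (\<forall>y\<in>S. y \<in> A \<longrightarrow> f y \<in> U)"
    using open_cylinder[of I x] by (intro exI[of _ "{y. \<forall>i\<in>I. y i = x i}"]) auto
qed

lemma continuous_on_cylinder_realI:
  fixes f :: "('i \<Rightarrow> 'b::discrete_topology) \<Rightarrow> real"
  assumes "\<And>x \<epsilon>. x \<in> S \<Longrightarrow> \<epsilon> > 0 \<Longrightarrow>
    \<exists>I. finite I \<and> (\<forall>y\<in>S. (\<forall>i\<in>I. y i = x i) \<longrightarrow> \<bar>f y - f x\<bar> < \<epsilon>)"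
  shows "continuous_on S f"
proof (rule continuous_on_cylinderI)
  fix x U
  assume x: "x \<in> S" and U: "open U" "f x \<in> U"
  then obtain \<epsilon> where e: "\<epsilon> > 0" "\<And>t. \<bar>t - f x\<bar> < \<epsilon> \<Longrightarrow> t \<in> U"
    unfolding open_dist dist_real_def by blast
  show "\<exists>I. finite I \<and> (\<forall>y\<in>S. (\<forall>i\<in>I. y i = x i) \<longrightarrow> f y \<in> U)"
    using assms[OF x e(1)] e(2) by blast
qed

lemma continuous_on_discrete_topology:
  fixes f :: "'a::discrete_topology \<Rightarrow> 'b::topological_space"
  shows "continuous_on S f"
  unfolding continuous_on_topological
proof (intro ballI allI impI)
  fix x B
  assume "f x \<in> B"
  then show "\<exists>A. open A \<and> x \<in> A \<and> (\<forall>y\<in>S. y \<in> A \<longrightarrow> f y \<in> B)"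
    by (intro exI[of _ "{x}"]) (simp add: open_discrete)
qed

lemma compact_UNIV_fun: "compact (UNIV :: ('i \<Rightarrow> 'b::{topological_space, finite}) set)"
proof -
  have "compact_space (product_topology (\<lambda>_::'i. euclidean :: 'b topology) UNIV)"
    unfolding compact_space_product_topology
    using finite_imp_compact[of "UNIV :: 'b set"] by (simp add: compact_space_def compactin_euclidean_iff)
  then show ?thesis
    by (simp add: euclidean_product_topology compact_space_def compactin_euclidean_iff)
qed

lemma closed_if_cylinder_approximable:
  fixes S :: "('i \<Rightarrow> 'b::topological_space) set"
  assumes "closed S" "\<And>I. finite I \<Longrightarrow> \<exists>y\<in>S. \<forall>i\<in>I. y i = x i"
  shows "x \<in> S"
proof (rule ccontr)
  assume "x \<notin> S"
  then obtain I where "finite I" "\<And>y. (\<And>i. i \<in> I \<Longrightarrow> y i = x i) \<Longrightarrow> y \<in> - S"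
    using open_contains_cylinder[of "- S" x] assms(1) by auto
  then show False
    using assms(2)[of I] by auto
qed

text \<open>The separation classes make the results on compact sets in Hausdorff types available for
  sets of matrices and of functions, above all that continuous injections of compact sets are
  homeomorphisms onto their images.\<close>

instance "fun" :: (type, t0_space) t0_space
proof
  fix x y :: "'a \<Rightarrow> 'b"
  assume "x \<noteq> y"
  then obtain i where ne: "x i \<noteq> y i"
    by (auto simp: fun_eq_iff)
  obtain U where U: "open U" "\<not> (x i \<in> U \<longleftrightarrow> y i \<in> U)"
    using ne separation_t0 by blast
  show "\<exists>U. open U \<and> \<not> (x \<in> U \<longleftrightarrow> y \<in> U)"
  proof (intro exI conjI)
    show "open ((\<lambda>z. z i) -` U)"
      by (intro open_vimage U(1) continuous_on_product_coordinates)
  qed (use U in simp)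
qed

instance "fun" :: (type, t1_space) t1_space
proof
  fix x y :: "'a \<Rightarrow> 'b"
  assume "x \<noteq> y"
  then obtain i where ne: "x i \<noteq> y i"
    by (auto simp: fun_eq_iff)
  obtain U where U: "open U" "x i \<in> U" "y i \<notin> U"
    using ne separation_t1 by blast
  show "\<exists>U. open U \<and> x \<in> U \<and> y \<notin> U"
  proof (intro exI conjI)
    show "open ((\<lambda>z. z i) -` U)"
      by (intro open_vimage U(1) continuous_on_product_coordinates)
  qed (use U in simp_all)
qed

instance "fun" :: (type, t2_space) t2_space
proof
  fix x y :: "'a \<Rightarrow> 'b"
  assume "x \<noteq> y"
  then obtain i where ne: "x i \<noteq> y i"
    by (auto simp: fun_eq_iff)
  obtain U V where UV: "open U" "open V" "x i \<in> U" "y i \<in> V" "U \<inter> V = {}"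
    using hausdorff[OF ne] by blast
  show "\<exists>U V. open U \<and> open V \<and> x \<in> U \<and> y \<in> V \<and> U \<inter> V = {}"
  proof (intro exI conjI)
    show "open ((\<lambda>z. z i) -` U)" "open ((\<lambda>z. z i) -` V)"
      by (intro open_vimage UV(1,2) continuous_on_product_coordinates)+
  qed (use UV in auto)
qed

section \<open>The Cantor set\<close>

text \<open>An element not exceeding \<open>n\<close> is found by counting inside
  \<open>{..n}\<close>, so the rest of the set cannot matter. The sets will be the branching
  positions of two points that agree on an initial segment.\<close>

lemma enumerate_cong_atMost:
  fixes S S' :: "nat set"
  assumes "infinite S" "infinite S'" "S \<inter> {..n} = S' \<inter> {..n}" "enumerate S k \<le> n"
  shows "enumerate S' k = enumerate S k"
proof -
  have iff: "m \<in> S \<longleftrightarrow> m \<in> S'" if "m \<le> n" for m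
    using assms(3) that by blast
  show ?thesis
    using assms(4)
  proof (induction k)
    case 0
    have *: "enumerate S 0 \<in> S'"
      using 0 iff enumerate_in_set[OF assms(1), of 0] by simp
    moreover have "enumerate S 0 \<le> m" if "m \<in> S'" for m
    proof (rule ccontr)
      assume c: "\<not> enumerate S 0 \<le> m"
      then have "m \<in> S"
        using that 0 iff by simp
      then show False
        using c by (simp add: enumerate_0 Least_le)
    qed
    ultimately show ?case
      unfolding enumerate_0[of S'] by (intro Least_equality) auto
  next
    case (Suc k)
    have lt: "enumerate S k < enumerate S (Suc k)"
      by (rule enumerate_step[OF assms(1)])
    then have IH: "enumerate S' k = enumerate S k"
      using Suc by simp
    have "enumerate S (Suc k) \<in> S'"
      using Suc.prems iff enumerate_in_set[OF assms(1), of "Suc k"] by simp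
    moreover have "enumerate S (Suc k) \<le> m" if "m \<in> S'" "enumerate S k < m" for m
    proof (rule ccontr)
      assume c: "\<not> enumerate S (Suc k) \<le> m"
      then have "m \<in> S"
        using that(1) Suc.prems iff by simp
      then have "enumerate S (Suc k) \<le> m"
        unfolding enumerate_Suc''[OF assms(1)] by (intro Least_le conjI that(2))
      then show False
        using c by simp
    qed
    ultimately show ?case
      unfolding enumerate_Suc''[OF assms(2)] IH using lt by (intro Least_equality) auto
  qed
qed

text \<open>
  A point of a perfect set \<open>T\<close> is encoded by its bits at those positions where the tree of \<open>T\<close>
  branches along this point.
\<close>

lemma perfect_homeomorphic_Cantor_space:
  fixes T :: "(nat \<Rightarrow> bool) set"
  assumes T: "closed T" "T \<noteq> {}"
    and perfect: "\<And>x n. x \<in> T \<Longrightarrow> \<exists>y\<in>T. (\<forall>i<n. y i = x i) \<and> y \<noteq> x"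
  shows "T homeomorphic (UNIV :: (nat \<Rightarrow> bool) set)"
proof -
  define br where "br x = {n. \<exists>y\<in>T. (\<forall>i<n. y i = x i) \<and> y n \<noteq> x n}" for x
  define \<Psi> where "\<Psi> x k = x (enumerate (br x) k)" for x k
  \<comment> \<open>Agreement strictly below \<open>n\<close> already settles position
    \<open>n\<close>: if the points differ there, each witnesses that the other branches. So two
    points that part at \<open>n\<close> give \<open>n\<close> the same number in their
    enumerations, which yields injectivity.\<close>
  have br_cong: "br x \<inter> {..n} = br y \<inter> {..n}"
    if xy: "x \<in> T" "y \<in> T" "\<forall>i<n. y i = x i" for x y n
  proof -
    have "m \<in> br y" if a: "m \<in> br x" "m \<le> n" "x \<in> T" "y \<in> T" "\<forall>i<n. y i = x i" for m x y
    proof (cases "y m = x m")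
      case True
      obtain z where z: "z \<in> T" "\<forall>i<m. z i = x i" "z m \<noteq> x m"
        using a by (auto simp: br_def)
      then have "\<forall>i<m. z i = y i" "z m \<noteq> y m"
        using a True by auto
      then show ?thesis
        using z(1) by (auto simp: br_def)
    next
      case False
      then show ?thesis
        using a by (auto simp: br_def intro!: bexI[of _ x])
    qed
    from this[of _ x y] this[of _ y x] show ?thesis
      using xy by auto
  qed
  have inf: "infinite (br x)" if x: "x \<in> T" for x
    unfolding infinite_nat_iff_unbounded_le
  proof
    fix n
    obtain y where y: "y \<in> T" "\<forall>i<n. y i = x i" "y \<noteq> x"
      using perfect[OF x] by blast
    define m where "m = (LEAST m. y m \<noteq> x m)"
    have m: "y m \<noteq> x m"
      unfolding m_def by (rule LeastI_ex) (use y(3) in auto)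
    have "\<forall>i<m. y i = x i"
      unfolding m_def using not_less_Least by blast
    moreover have "n \<le> m"
      using m y(2) by (meson not_le)
    ultimately show "\<exists>m\<ge>n. m \<in> br x"
      using m y(1) by (auto simp: br_def)
  qed
  have enum_cong: "enumerate (br y) k = enumerate (br x) k"
    if "x \<in> T" "y \<in> T" "\<forall>i<n. y i = x i" "enumerate (br x) k \<le> n" for x y n k
    using enumerate_cong_atMost[OF inf inf br_cong] that by metis
  have cont: "continuous_on T \<Psi>"
  proof (rule continuous_on_coordinatewise_then_product, rule continuous_on_cylinderI)
    fix k x U
    assume x: "x \<in> T" and U: "\<Psi> x k \<in> U"
    define n where "n = enumerate (br x) k"
    have "\<Psi> y k = \<Psi> x k" if y: "y \<in> T" "\<forall>i\<in>{..n}. y i = x i" for y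
      using enum_cong[OF x y(1), of n k] y(2) by (auto simp: \<Psi>_def n_def)
    with U show "\<exists>I. finite I \<and> (\<forall>y\<in>T. (\<forall>i\<in>I. y i = x i) \<longrightarrow> \<Psi> y k \<in> U)"
      by (intro exI[of _ "{..n}"]) auto
  qed
  have inj: "inj_on \<Psi> T"
  proof (rule inj_onI, rule ccontr)
    fix x y
    assume x: "x \<in> T" and y: "y \<in> T" and eq: "\<Psi> x = \<Psi> y" and ne: "x \<noteq> y"
    define m where "m = (LEAST m. y m \<noteq> x m)"
    have m: "y m \<noteq> x m"
      unfolding m_def by (rule LeastI_ex) (use ne in auto)
    have below: "\<forall>i<m. y i = x i"
      unfolding m_def using not_less_Least by blast
    then have "m \<in> br x"
      using m y by (auto simp: br_def)
    then obtain k where k: "enumerate (br x) k = m"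
      using enumerate_Ex[OF inf[OF x]] by blast
    then have "enumerate (br y) k = m"
      using enum_cong[OF x y below] by simp
    then show False
      using fun_cong[OF eq, of k] k m by (simp add: \<Psi>_def)
  qed
  \<comment> \<open>If bit \<open>k\<close> of \<open>x\<close> is wrong, a point \<open>y\<close>
    that leaves \<open>x\<close> at the \<open>k\<close>-th branching position has the other, hence
    the right, bit there; by \<open>enum_cong\<close> the earlier bits stay.\<close>
  have dense: "\<exists>x\<in>T. \<forall>i<k. \<Psi> x i = z i" for z k
  proof (induction k)
    case 0
    then show ?case
      using T(2) by auto
  next
    case (Suc k)
    then obtain x where x: "x \<in> T" "\<forall>i<k. \<Psi> x i = z i"
      by blast
    define n where "n = enumerate (br x) k"
    have "n \<in> br x"
      unfolding n_def by (rule enumerate_in_set[OF inf[OF x(1)]])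
    then obtain y where y: "y \<in> T" "\<forall>i<n. y i = x i" "y n \<noteq> x n"
      by (auto simp: br_def)
    have enum: "enumerate (br y) i = enumerate (br x) i" if "i \<le> k" for i
      by (rule enum_cong[OF x(1) y(1,2)]) (simp add: n_def enumerate_mono_le_iff[OF inf[OF x(1)]] that)
    have "\<Psi> y i = z i" if "i < k" for i
    proof -
      have "enumerate (br x) i < n"
        unfolding n_def by (rule enumerate_mono[OF that inf[OF x(1)]])
      then have "\<Psi> y i = \<Psi> x i"
        unfolding \<Psi>_def using enum that y(2) by simp
      then show ?thesis
        using x(2) that by simp
    qed
    moreover have "\<Psi> y k \<noteq> \<Psi> x k"
      using enum[of k] y(3) by (simp add: \<Psi>_def n_def)
    ultimately have "(\<forall>i<Suc k. \<Psi> x i = z i) \<or> (\<forall>i<Suc k. \<Psi> y i = z i)"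
      using x(2) by (auto simp: less_Suc_eq)
    then show ?case
      using x(1) y(1) by blast
  qed
  have cT: "compact T"
    using compact_Int_closed[OF compact_UNIV_fun T(1)] by simp
  have "\<Psi> ` T = UNIV"
  proof (rule equalityI[OF subset_UNIV], rule subsetI)
    fix z :: "nat \<Rightarrow> bool"
    show "z \<in> \<Psi> ` T"
    proof (rule closed_if_cylinder_approximable)
      show "closed (\<Psi> ` T)"
        by (rule compact_imp_closed[OF compact_continuous_image[OF cont cT]])
      fix I :: "nat set"
      assume "finite I"
      then obtain k where k: "I \<subseteq> {..<k}"
        using finite_nat_iff_bounded by blast
      obtain x where "x \<in> T" "\<forall>i<k. \<Psi> x i = z i"
        using dense by blast
      then show "\<exists>y\<in>\<Psi> ` T. \<forall>i\<in>I. y i = z i"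
        using k by blast
    qed
  qed
  then show ?thesis
    using homeomorphic_compact[OF cT cont _ inj] by blast
qed

section \<open>Ternary expansions and the middle-thirds set\<close>

definition ternary :: "(nat \<Rightarrow> bool) \<Rightarrow> real" where
  "ternary z = (\<Sum>n. 2 * of_bool (z n) / 3 ^ Suc n)"

lemma summable_ternary: "summable (\<lambda>n. 2 * of_bool (z n) / 3 ^ Suc n :: real)"
proof (rule summable_comparison_test')
  show "summable (\<lambda>n. 2 / 3 * (1 / 3) ^ n :: real)"
    by (intro summable_mult summable_geometric) auto
  show "norm (2 * of_bool (z n) / 3 ^ Suc n :: real) \<le> 2 / 3 * (1 / 3) ^ n" for n
    by (simp add: power_divide)
qed

text \<open>With digits 0 and 2, prepending a bit is one of the two contractions that build
  \<open>cantor_stage\<close>. Injectivity, continuity and the comparison with the stages are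
  inductions along this recursion.\<close>

lemma ternary_unfold: "ternary z = 2 / 3 * of_bool (z 0) + ternary (\<lambda>n. z (Suc n)) / 3"
proof -
  have "ternary (\<lambda>n. z (Suc n)) / 3 = (\<Sum>n. 2 * of_bool (z (Suc n)) / 3 ^ Suc (Suc n))"
    unfolding ternary_def suminf_divide[OF summable_ternary, symmetric] by (simp add: mult_ac)
  also have "\<dots> = ternary z - 2 * of_bool (z 0) / 3 ^ Suc 0"
    using suminf_split_head[OF summable_ternary[of z]] by (simp add: ternary_def)
  finally show ?thesis
    by (simp add: field_simps)
qed

lemma ternary_bounds: "0 \<le> ternary z" "ternary z \<le> 1"
proof -
  show "0 \<le> ternary z"
    unfolding ternary_def by (rule suminf_nonneg[OF summable_ternary]) simp
  have "ternary z \<le> (\<Sum>n. 2 / 3 * (1 / 3) ^ n)"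
    unfolding ternary_def
    by (intro suminf_le summable_ternary summable_mult summable_geometric) (auto simp: power_divide)
  also have "\<dots> = 1"
    by (subst suminf_mult) (auto simp: suminf_geometric)
  finally show "ternary z \<le> 1" .
qed

text \<open>A first bit \<open>False\<close> puts the value into \<open>{0..1/3}\<close>, a first
  bit \<open>True\<close> into \<open>{2/3..1}\<close>. These are disjoint, so the first bit can be
  read off, and the recursion reaches the others.\<close>

lemma ternary_inj: "inj ternary"
proof (rule injI, rule ext)
  show "y n = z n" if "ternary y = ternary z" for y z n
    using that
  proof (induction n arbitrary: y z)
    case (0 y z)
    then show ?case
      using ternary_unfold[of y] ternary_unfold[of z]
        ternary_bounds[of "\<lambda>n. y (Suc n)"] ternary_bounds[of "\<lambda>n. z (Suc n)"]
      by (cases "y 0"; cases "z 0") auto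
  next
    case (Suc n y z)
    have "y 0 = z 0"
      using Suc.prems ternary_unfold[of y] ternary_unfold[of z]
        ternary_bounds[of "\<lambda>n. y (Suc n)"] ternary_bounds[of "\<lambda>n. z (Suc n)"]
      by (cases "y 0"; cases "z 0") auto
    then show ?case
      using Suc.prems ternary_unfold[of y] ternary_unfold[of z] by (intro Suc.IH) simp
  qed
qed

lemma ternary_close: "\<forall>i<n. y i = z i \<Longrightarrow> \<bar>ternary y - ternary z\<bar> \<le> (1 / 3) ^ n"
proof (induction n arbitrary: y z)
  case 0
  then show ?case
    using ternary_bounds[of y] ternary_bounds[of z] by simp
next
  case (Suc n)
  then have "\<bar>ternary (\<lambda>n. y (Suc n)) - ternary (\<lambda>n. z (Suc n))\<bar> \<le> (1 / 3) ^ n"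
    by auto
  then show ?case
    using Suc.prems ternary_unfold[of y] ternary_unfold[of z] by (simp flip: diff_divide_distrib)
qed

lemma pow_third_less:
  assumes "(\<epsilon>::real) > 0"
  obtains n where "(1 / 3) ^ n < \<epsilon>"
  using real_arch_pow_inv[OF assms, of "1/3"] by auto

lemma continuous_on_ternary: "continuous_on S ternary"
proof (rule continuous_on_cylinder_realI)
  fix z and \<epsilon> :: real
  assume "\<epsilon> > 0"
  then obtain n where n: "(1 / 3) ^ n < \<epsilon>"
    by (rule pow_third_less)
  have "\<bar>ternary y - ternary z\<bar> < \<epsilon>" if "\<forall>i\<in>{..<n}. y i = z i" for y
    using ternary_close[of n y z] n that by simp
  then show "\<exists>I. finite I \<and> (\<forall>y\<in>S. (\<forall>i\<in>I. y i = z i) \<longrightarrow> \<bar>ternary y - ternary z\<bar> < \<epsilon>)"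
    by blast
qed

lemma ternary_in_cantor_stage: "ternary z \<in> cantor_stage n"
proof (induction n arbitrary: z)
  case 0
  then show ?case
    using ternary_bounds by simp
next
  case (Suc n)
  show ?case
    using Suc[of "\<lambda>n. z (Suc n)"] ternary_unfold[of z] by (cases "z 0") auto
qed

text \<open>The contractions leading to \<open>x\<close> prescribe the first \<open>n\<close> bits
  of \<open>z\<close>, and each divides an initial error of at most 1 by 3. Hence points of
  \<open>cantor_set\<close> are limits of values of \<open>ternary\<close>, which is enough because
  its range is compact.\<close>

lemma cantor_stage_near_ternary:
  "x \<in> cantor_stage n \<Longrightarrow> \<exists>z. \<bar>x - ternary z\<bar> \<le> (1 / 3) ^ n"
proof (induction n arbitrary: x)
  case 0
  then show ?case
    using ternary_bounds[of "\<lambda>_. True"] by (intro exI[of _ "\<lambda>_. True"]) auto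
next
  case (Suc n)
  then obtain y b where y: "y \<in> cantor_stage n" and x: "x = 2 / 3 * of_bool b + y / 3"
    by (auto intro: that[of _ False] that[of _ True])
  obtain z where z: "\<bar>y - ternary z\<bar> \<le> (1 / 3) ^ n"
    using Suc.IH[OF y] by blast
  have "ternary (case_nat b z) = 2 / 3 * of_bool b + ternary z / 3"
    by (subst ternary_unfold) simp
  then show ?case
    using z x by (intro exI[of _ "case_nat b z"]) (simp flip: diff_divide_distrib)
qed

lemma range_ternary: "range ternary = cantor_set"
proof
  show "range ternary \<subseteq> cantor_set"
    using ternary_in_cantor_stage by (auto simp: cantor_set_def)
  have closed: "closed (range ternary)"
    by (intro compact_imp_closed compact_continuous_image continuous_on_ternary compact_UNIV_fun)
  show "cantor_set \<subseteq> range ternary"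
  proof
    fix x
    assume x: "x \<in> cantor_set"
    have "\<exists>y\<in>range ternary. dist y x < \<epsilon>" if "\<epsilon> > 0" for \<epsilon>
    proof -
      obtain n where n: "(1 / 3) ^ n < \<epsilon>"
        using \<open>\<epsilon> > 0\<close> by (rule pow_third_less)
      obtain z where "\<bar>x - ternary z\<bar> \<le> (1 / 3) ^ n"
        using x cantor_stage_near_ternary[of x n] by (auto simp: cantor_set_def)
      with n show ?thesis
        by (intro bexI[of _ "ternary z"]) (auto simp: dist_real_def)
    qed
    then show "x \<in> range ternary"
      using closed closure_approachable closure_closed by metis
  qed
qed

lemma Cantor_space_homeomorphic_cantor_set: "(UNIV :: (nat \<Rightarrow> bool) set) homeomorphic cantor_set"
  by (rule homeomorphic_compact[OF compact_UNIV_fun continuous_on_ternary range_ternary ternary_inj])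

section \<open>Weak topologies and WAP functions\<close>

lemma topspace_weak_topology [simp]: "topspace weak_topology = UNIV"
  by (simp add: weak_topology_def topspace_pullback_topology)

text \<open>The universal property of an initial topology; it reduces weak continuity to scalar
  functions, one functional at a time.\<close>

lemma continuous_map_weak_topology_iff:
  "continuous_map X weak_topology f \<longleftrightarrow>
    (\<forall>\<phi>. continuous_map X euclideanreal (\<lambda>x. blinfun_apply \<phi> (f x)))"
proof
  assume f: "continuous_map X weak_topology f"
  show "\<forall>\<phi>. continuous_map X euclideanreal (\<lambda>x. blinfun_apply \<phi> (f x))"
  proof
    fix \<phi> :: "'b \<Rightarrow>\<^sub>L real"
    have "continuous_map (product_topology (\<lambda>_. euclideanreal) UNIV) euclideanreal (\<lambda>y. y \<phi>)"
      by (rule continuous_map_product_projection) simp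
    then have "continuous_map (pullback_topology UNIV (\<lambda>x \<phi>. blinfun_apply \<phi> x)
        (product_topology (\<lambda>_. euclideanreal) UNIV)) euclideanreal ((\<lambda>y. y \<phi>) \<circ> (\<lambda>x \<phi>. blinfun_apply \<phi> x))"
      by (rule continuous_map_pullback)
    then have "continuous_map weak_topology euclideanreal (blinfun_apply \<phi>)"
      by (simp add: weak_topology_def o_def)
    with f show "continuous_map X euclideanreal (\<lambda>x. blinfun_apply \<phi> (f x))"
      using continuous_map_compose by (fastforce simp: o_def)
  qed
next
  assume "\<forall>\<phi>. continuous_map X euclideanreal (\<lambda>x. blinfun_apply \<phi> (f x))"
  then have "continuous_map X (product_topology (\<lambda>_. euclideanreal) UNIV)
      ((\<lambda>x \<phi>. blinfun_apply \<phi> x) \<circ> f)"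
    by (simp add: continuous_map_componentwise_UNIV o_def)
  then show "continuous_map X weak_topology f"
    unfolding weak_topology_def by (rule continuous_map_pullback') auto
qed

lemma continuous_map_blinfun_apply:
  fixes \<phi> :: "'a::real_normed_vector \<Rightarrow>\<^sub>L real"
  shows "continuous_map weak_topology euclideanreal (blinfun_apply \<phi>)"
  using continuous_map_weak_topology_iff[of "weak_topology :: 'a topology" "\<lambda>x. x"] by simp

lemma bounded_linear_eval_bcontfun:
  "bounded_linear (\<lambda>f :: 'g::topological_space \<Rightarrow>\<^sub>C real. apply_bcontfun f x)"
proof (rule bounded_linear_intro[where K=1])
  show "norm (apply_bcontfun f x) \<le> norm f * 1" for f :: "'g \<Rightarrow>\<^sub>C real"
    using norm_bounded[of f x] by simp
qed (auto simp: plus_bcontfun.rep_eq scaleR_bcontfun.rep_eq)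

lemma continuous_map_eval_weak_topology:
  "continuous_map (weak_topology :: ('g::topological_space \<Rightarrow>\<^sub>C real) topology) euclideanreal
    (\<lambda>f. apply_bcontfun f x)"
  using continuous_map_blinfun_apply[of "Blinfun (\<lambda>f :: 'g \<Rightarrow>\<^sub>C real. apply_bcontfun f x)"]
  by (simp add: bounded_linear_eval_bcontfun bounded_linear_Blinfun_apply)

lemma continuous_map_apply_bcontfun_weak_topology:
  "continuous_map (weak_topology :: ('g::topological_space \<Rightarrow>\<^sub>C real) topology) euclidean apply_bcontfun"
  unfolding euclidean_product_topology[symmetric]
  by (simp add: continuous_map_componentwise_UNIV continuous_map_eval_weak_topology)

lemma Hausdorff_space_euclidean_t2: "Hausdorff_space (euclidean :: 'a::t2_space topology)"
  unfolding Hausdorff_space_def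
proof (intro allI impI)
  fix x y :: 'a
  assume "x \<in> topspace euclidean \<and> y \<in> topspace euclidean \<and> x \<noteq> y"
  then have "x \<noteq> y"
    by simp
  from hausdorff[OF this]
  show "\<exists>U V. openin euclidean U \<and> openin euclidean V \<and> x \<in> U \<and> y \<in> V \<and> disjnt U V"
    by (simp add: disjnt_def)
qed

text \<open>Point evaluations are bounded functionals, so the weak topology refines the Hausdorff
  topology of pointwise convergence.\<close>

lemma Hausdorff_weak_topology_bcontfun:
  "Hausdorff_space (weak_topology :: ('g::topological_space \<Rightarrow>\<^sub>C real) topology)"
  by (rule Hausdorff_space_injective_preimage
      [OF Hausdorff_space_euclidean_t2 continuous_map_apply_bcontfun_weak_topology])
    (auto simp: inj_on_def apply_bcontfun_inject)

text \<open>
  The weak topology on a weakly compact set is the topology of pointwise convergence, as the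
  latter is a coarser Hausdorff topology.
\<close>

lemma continuous_map_into_weakly_compact:
  fixes F :: "'a \<Rightarrow> ('g::topological_space \<Rightarrow>\<^sub>C real)"
  assumes C: "compactin weak_topology C" and F: "F ` topspace X \<subseteq> C"
    and cont: "\<And>x. continuous_map X euclideanreal (\<lambda>a. apply_bcontfun (F a) x)"
  shows "continuous_map X weak_topology F"
proof -
  let ?W = "subtopology weak_topology C"
  let ?P = "subtopology euclidean (apply_bcontfun ` C)"
  have "homeomorphic_map ?W ?P apply_bcontfun"
  proof (rule continuous_imp_homeomorphic_map)
    show "continuous_map ?W ?P apply_bcontfun"
      unfolding continuous_map_in_subtopology
      by (auto intro: continuous_map_from_subtopology continuous_map_apply_bcontfun_weak_topology)
    show "compact_space ?W"
      using C by (simp add: compact_space_subtopology)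
    show "Hausdorff_space ?P"
      by (intro Hausdorff_space_subtopology Hausdorff_space_euclidean_t2)
  qed (auto simp: inj_on_def apply_bcontfun_inject)
  then obtain k where k: "continuous_map ?P ?W k" "\<And>f. f \<in> C \<Longrightarrow> k (apply_bcontfun f) = f"
    by (auto simp: homeomorphic_map_maps homeomorphic_maps_def)
  have "continuous_map X euclidean (\<lambda>a. apply_bcontfun (F a))"
    unfolding euclidean_product_topology[symmetric]
    by (simp add: continuous_map_componentwise_UNIV cont)
  then have "continuous_map X ?P (\<lambda>a. apply_bcontfun (F a))"
    using F by (auto simp: continuous_map_in_subtopology)
  then have "continuous_map X ?W (k \<circ> (\<lambda>a. apply_bcontfun (F a)))"
    by (rule continuous_map_compose[OF _ k(1)])
  then have "continuous_map X weak_topology (k \<circ> (\<lambda>a. apply_bcontfun (F a)))"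
    by (simp add: continuous_map_in_subtopology)
  then show ?thesis
    by (rule continuous_map_eq) (use F k(2) in auto)
qed

lemma relatively_weakly_compactI:
  fixes C :: "('g::topological_space \<Rightarrow>\<^sub>C real) set"
  assumes "compactin weak_topology C" "S \<subseteq> C"
  shows "relatively_weakly_compact S"
  unfolding relatively_weakly_compact_def
proof (rule closed_compactin[OF assms(1)])
  have "closedin weak_topology C"
    by (rule compactin_imp_closedin[OF Hausdorff_weak_topology_bcontfun assms(1)])
  then show "weak_topology closure_of S \<subseteq> C"
    by (rule closure_of_minimal[OF assms(2)])
qed auto

section \<open>WAP functions are uniformly continuous\<close>

text \<open>
  A compact set of continuous functions on a separable space is homeomorphic to its set of
  restrictions to a countable dense set, hence second countable. So the space is covered by
  countably many closed sets on each of which the whole set oscillates by at most \<open>\<epsilon>\<close>.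
\<close>

lemma pointwise_compact_small_oscillation:
  fixes L :: "('a::topological_space \<Rightarrow> real) set"
  assumes baire: "\<And>\<F>. countable \<F> \<Longrightarrow> (\<And>S. S \<in> \<F> \<Longrightarrow> closed S) \<Longrightarrow> \<Union>\<F> = (UNIV :: 'a set) \<Longrightarrow>
      \<exists>S\<in>\<F>. interior S \<noteq> {}"
    and D: "countable D" "closure D = (UNIV :: 'a set)"
    and L: "compact L" "\<And>h. h \<in> L \<Longrightarrow> continuous_on UNIV h"
    and "\<epsilon> > 0"
  obtains U where "open U" "U \<noteq> {}" "\<And>h x y. h \<in> L \<Longrightarrow> x \<in> U \<Longrightarrow> y \<in> U \<Longrightarrow> \<bar>h x - h y\<bar> \<le> \<epsilon>"
proof -
  have Dne: "D \<noteq> {}"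
    using D(2) by auto
  define \<rho> where "\<rho> h = (\<lambda>n. h (from_nat_into D n))" for h :: "'a \<Rightarrow> real"
  have eval: "continuous_on S (\<lambda>h :: 'a \<Rightarrow> real. h x)" for S x
    by (rule continuous_on_subset[OF continuous_on_product_coordinates]) simp
  have \<rho>_cont: "continuous_on S \<rho>" for S
    unfolding \<rho>_def by (intro continuous_on_coordinatewise_then_product eval)
  have \<rho>_inj: "h = k" if "h \<in> L" "k \<in> L" "\<rho> h = \<rho> k" for h k
  proof -
    have "h d = k d" if "d \<in> D" for d
      using fun_cong[OF \<open>\<rho> h = \<rho> k\<close>, of "to_nat_on D d"] that D(1) by (simp add: \<rho>_def)
    moreover have "closed {x. h x = k x}"
      using L(2) that by (intro closed_Collect_eq) auto
    ultimately have "closure D \<subseteq> {x. h x = k x}"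
      by (intro closure_minimal) auto
    then show ?thesis
      using D(2) by auto
  qed
  obtain \<B> :: "(nat \<Rightarrow> real) set set" where \<B>: "countable \<B>" "topological_basis \<B>"
    using ex_countable_basis by blast
  define Z where "Z P = {x. \<forall>p\<in>P. \<forall>h\<in>L. \<rho> h \<in> fst p \<longrightarrow> \<bar>h x - snd p\<bar> \<le> \<epsilon> / 2}"
    for P :: "((nat \<Rightarrow> real) set \<times> real) set"
  define \<P> where "\<P> = {P. finite P \<and> P \<subseteq> \<B> \<times> (\<rat> :: real set) \<and> \<rho> ` L \<subseteq> \<Union> (fst ` P)}"
  have "countable \<P>"
  proof (rule countable_subset)
    show "\<P> \<subseteq> {P. P \<subseteq> \<B> \<times> \<rat> \<and> finite P}"
      by (auto simp: \<P>_def)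
    show "countable {P. P \<subseteq> \<B> \<times> (\<rat> :: real set) \<and> finite P}"
      using countable_Collect_finite_subset[OF countable_SIGMA[OF \<B>(1) countable_rat]]
      by (simp add: conj_commute)
  qed
  moreover have "closed (Z P)" for P
  proof -
    have "Z P = (\<Inter>p\<in>P. \<Inter>h\<in>{h\<in>L. \<rho> h \<in> fst p}. {x. \<bar>h x - snd p\<bar> \<le> \<epsilon> / 2})"
      by (auto simp: Z_def)
    also have "closed \<dots>"
      using L(2) by (intro closed_INT ballI closed_Collect_le continuous_intros) auto
    finally show ?thesis .
  qed
  moreover have "x \<in> \<Union> (Z ` \<P>)" for x
  proof -
    have "\<exists>b q. b \<in> \<B> \<and> q \<in> \<rat> \<and> \<rho> h \<in> b \<and> (\<forall>k\<in>L. \<rho> k \<in> b \<longrightarrow> \<bar>k x - q\<bar> \<le> \<epsilon> / 2)"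
      if h: "h \<in> L" for h
    proof -
      obtain q where q: "q \<in> \<rat>" "h x < q" "q < h x + \<epsilon> / 2"
        using Rats_dense_in_real[of "h x" "h x + \<epsilon> / 2"] \<open>\<epsilon> > 0\<close> by auto
      \<comment> \<open>The functions for which \<open>q\<close> is a wrong guess at
        \<open>x\<close> form a compact set. Its image under the map \<open>\<rho>\<close>,
        injective on \<open>L\<close>, is closed and misses \<open>\<rho> h\<close>, so a basic
        neighbourhood \<open>b\<close> of \<open>\<rho> h\<close> avoids it.\<close>
      define N where "N = L \<inter> {k. \<epsilon> / 2 \<le> \<bar>k x - q\<bar>}"
      have "compact N"
        unfolding N_def by (intro compact_Int_closed L closed_Collect_le continuous_intros eval)
      then have "closed (\<rho> ` N)"
        by (intro compact_imp_closed compact_continuous_image \<rho>_cont)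
      then have "open (- (\<rho> ` N))"
        by (rule open_Compl)
      moreover have "\<rho> h \<in> - (\<rho> ` N)"
        using \<rho>_inj[OF h] q by (auto simp: N_def)
      ultimately obtain b where b: "b \<in> \<B>" "\<rho> h \<in> b" "b \<subseteq> - (\<rho> ` N)"
        by (rule topological_basisE[OF \<B>(2)])
      then have "\<bar>k x - q\<bar> \<le> \<epsilon> / 2" if "k \<in> L" "\<rho> k \<in> b" for k
        using that by (force simp: N_def)
      with b q show ?thesis
        by blast
    qed
    then obtain b q where bq: "\<And>h. h \<in> L \<Longrightarrow> b h \<in> \<B> \<and> q h \<in> \<rat> \<and> \<rho> h \<in> b h \<and>
        (\<forall>k\<in>L. \<rho> k \<in> b h \<longrightarrow> \<bar>k x - q h\<bar> \<le> \<epsilon> / 2)"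
      by metis
    have "compact (\<rho> ` L)"
      by (intro compact_continuous_image \<rho>_cont L(1))
    moreover have "\<And>h. h \<in> L \<Longrightarrow> open (b h)"
      using bq topological_basis_open[OF \<B>(2)] by blast
    moreover have "\<rho> ` L \<subseteq> (\<Union>h\<in>L. b h)"
      using bq by auto
    ultimately obtain H where H: "H \<subseteq> L" "finite H" "\<rho> ` L \<subseteq> (\<Union>h\<in>H. b h)"
      by (rule compactE_image)
    then have "(\<lambda>h. (b h, q h)) ` H \<in> \<P>"
      using bq by (auto simp: \<P>_def image_image)
    moreover have "x \<in> Z ((\<lambda>h. (b h, q h)) ` H)"
      using H(1) bq by (auto simp: Z_def)
    ultimately show ?thesis
      by blast
  qed
  ultimately obtain P where P: "P \<in> \<P>" "interior (Z P) \<noteq> {}"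
    using baire[of "Z ` \<P>"] by blast
  show thesis
  proof
    show "open (interior (Z P))" "interior (Z P) \<noteq> {}"
      using P by auto
    fix h x y
    assume h: "h \<in> L" and xy: "x \<in> interior (Z P)" "y \<in> interior (Z P)"
    have "\<rho> h \<in> \<Union> (fst ` P)"
      using P(1) h by (auto simp: \<P>_def)
    then obtain p where "p \<in> P" "\<rho> h \<in> fst p"
      by blast
    moreover have "x \<in> Z P" "y \<in> Z P"
      using xy interior_subset by blast+
    ultimately have "\<bar>h x - snd p\<bar> \<le> \<epsilon> / 2" "\<bar>h y - snd p\<bar> \<le> \<epsilon> / 2"
      using h by (auto simp: Z_def)
    then show "\<bar>h x - h y\<bar> \<le> \<epsilon>"
      by linarith
  qed
qed

text \<open>Banach-Alaoglu: linearity is a closed condition in a product of compact intervals.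
  Functionals are taken as plain functions so that the weak-star topology is the product topology of
  the function type.\<close>

lemma compact_dual_ball:
  "compact {\<delta> :: 'b::real_normed_vector \<Rightarrow> real.
    (\<forall>u v. \<delta> (u + v) = \<delta> u + \<delta> v) \<and> (\<forall>c u. \<delta> (c *\<^sub>R u) = c * \<delta> u) \<and> (\<forall>u. \<bar>\<delta> u\<bar> \<le> norm u)}"
  (is "compact ?B")
proof -
  have "compactin (product_topology (\<lambda>_::'b. euclideanreal) UNIV) (Pi\<^sub>E UNIV (\<lambda>u. {- norm u..norm u}))"
    by (simp add: compactin_PiE)
  then have c: "compact (Pi\<^sub>E UNIV (\<lambda>u::'b. {- norm u..norm u}))"
    by (simp add: euclidean_product_topology)
  have eval: "continuous_on S (\<lambda>\<delta> :: 'b \<Rightarrow> real. \<delta> u)" for S u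
    by (rule continuous_on_subset[OF continuous_on_product_coordinates]) simp
  have "closed ((\<Inter>u. \<Inter>v. {\<delta> :: 'b \<Rightarrow> real. \<delta> (u + v) = \<delta> u + \<delta> v}) \<inter>
      (\<Inter>c. \<Inter>u. {\<delta>. \<delta> (c *\<^sub>R u) = c * \<delta> u}))"
    by (intro closed_Int closed_INT ballI closed_Collect_eq continuous_intros eval)
  moreover have "\<delta> u \<in> {- norm u..norm u} \<longleftrightarrow> \<bar>\<delta> u\<bar> \<le> norm u" for \<delta> :: "'b \<Rightarrow> real" and u
    by auto
  then have "?B = Pi\<^sub>E UNIV (\<lambda>u::'b. {- norm u..norm u}) \<inter>
      ((\<Inter>u. \<Inter>v. {\<delta> :: 'b \<Rightarrow> real. \<delta> (u + v) = \<delta> u + \<delta> v}) \<inter>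
      (\<Inter>c. \<Inter>u. {\<delta>. \<delta> (c *\<^sub>R u) = c * \<delta> u}))"
    by (auto simp: PiE_UNIV_domain Pi_iff simp del: atLeastAtMost_iff)
  ultimately show ?thesis
    using compact_Int_closed[OF c] by simp
qed

text \<open>The set \<open>C\<close> controls \<open>f\<close> at \<open>g + v\<close>, the set
  \<open>L\<close> controls it at \<open>v + g\<close>. The functions sending \<open>x\<close> to
  \<open>f (x + y)\<close> come from point evaluations; these lie in the dual unit ball, which
  supplies a compact set around them.\<close>

theorem WAP_subset_UC:
  fixes D :: "'g::topological_group_add set"
  assumes baire: "\<And>\<F>. countable \<F> \<Longrightarrow> (\<And>S. S \<in> \<F> \<Longrightarrow> closed S) \<Longrightarrow> \<Union>\<F> = (UNIV :: 'g set) \<Longrightarrow>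
      \<exists>S\<in>\<F>. interior S \<noteq> {}"
    and D: "countable D" "closure D = UNIV"
  shows "(WAP :: ('g \<Rightarrow>\<^sub>C real) set) \<subseteq> UC"
proof
  fix f :: "'g \<Rightarrow>\<^sub>C real"
  assume "f \<in> WAP"
  define C where "C = weak_topology closure_of (range (translate f))"
  have C: "compactin weak_topology C"
    using \<open>f \<in> WAP\<close> by (simp add: WAP_def relatively_weakly_compact_def C_def)
  have orbit: "translate f g \<in> C" for g
    using closure_of_subset[of "range (translate f)" weak_topology] by (auto simp: C_def)
  have fcont: "continuous_on S (apply_bcontfun f)" for S
    by (rule continuous_on_subset[OF _ subset_UNIV]) (use apply_bcontfun[of f] in \<open>simp add: bcontfun_def\<close>)
  \<comment> \<open>This makes the members of \<open>L\<close> continuous, for all functionals and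
    not only evaluations. Pointwise continuity suffices because the orbit lies in the weakly compact
    set \<open>C\<close>.\<close>
  have cont: "continuous_map euclidean weak_topology (translate f)"
  proof (rule continuous_map_into_weakly_compact[OF C])
    show "continuous_map euclidean euclideanreal (\<lambda>g. apply_bcontfun (translate f g) x)" for x
      unfolding translate.rep_eq continuous_map_iff_continuous2
      by (rule continuous_on_compose2[OF fcont[of UNIV]]) (auto intro!: continuous_intros)
  qed (use orbit in auto)
  define B where "B = {\<delta> :: ('g \<Rightarrow>\<^sub>C real) \<Rightarrow> real. (\<forall>u v. \<delta> (u + v) = \<delta> u + \<delta> v) \<and>
      (\<forall>c u. \<delta> (c *\<^sub>R u) = c * \<delta> u) \<and> (\<forall>u. \<bar>\<delta> u\<bar> \<le> norm u)}"
  define L where "L = (\<lambda>\<delta> x. \<delta> (translate f x)) ` B"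
  have L: "compact L"
    unfolding L_def B_def
    by (intro compact_continuous_image compact_dual_ball continuous_on_coordinatewise_then_product
        continuous_on_subset[OF continuous_on_product_coordinates subset_UNIV])
  have Lc: "continuous_on UNIV h" if h: "h \<in> L" for h
  proof -
    obtain \<delta> where \<delta>: "\<delta> \<in> B" "h = (\<lambda>x. \<delta> (translate f x))"
      using h by (auto simp: L_def)
    have "bounded_linear \<delta>"
      using \<delta>(1) by (intro bounded_linear_intro[where K=1]) (auto simp: B_def)
    moreover have "continuous_map euclidean euclideanreal (\<lambda>x. blinfun_apply (Blinfun \<delta>) (translate f x))"
      using cont by (simp add: continuous_map_weak_topology_iff)
    ultimately show ?thesis
      by (simp add: \<delta>(2) bounded_linear_Blinfun_apply)
  qed
  have evalB: "(\<lambda>h. apply_bcontfun h y) \<in> B" for y :: 'g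
    using norm_bounded[of "_ :: 'g \<Rightarrow>\<^sub>C real" y]
    by (simp add: B_def plus_bcontfun.rep_eq scaleR_bcontfun.rep_eq flip: real_norm_def)
  have L': "compact (apply_bcontfun ` C)"
    using image_compactin[OF C continuous_map_apply_bcontfun_weak_topology] by simp
  have L'c: "continuous_on UNIV h" if "h \<in> apply_bcontfun ` C" for h
    using that apply_bcontfun by (auto simp: bcontfun_def)
  show "f \<in> UC"
    unfolding UC_def
  proof (intro CollectI allI impI)
    fix \<epsilon> :: real
    assume "\<epsilon> > 0"
    \<comment> \<open>Half of \<open>\<epsilon>\<close>, because a bound on all values bounds the
      supremum only non-strictly.\<close>
    then have e: "\<epsilon> / 2 > 0"
      by simp
    obtain U where U: "open U" "U \<noteq> {}"
        "\<And>h x y. h \<in> L \<Longrightarrow> x \<in> U \<Longrightarrow> y \<in> U \<Longrightarrow> \<bar>h x - h y\<bar> \<le> \<epsilon> / 2"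
      using pointwise_compact_small_oscillation[OF baire D L Lc e] by blast
    obtain U' where U': "open U'" "U' \<noteq> {}"
        "\<And>h x y. h \<in> apply_bcontfun ` C \<Longrightarrow> x \<in> U' \<Longrightarrow> y \<in> U' \<Longrightarrow> \<bar>h x - h y\<bar> \<le> \<epsilon> / 2"
      using pointwise_compact_small_oscillation[OF baire D L' L'c e] by blast
    obtain x x' where x: "x \<in> U" "x' \<in> U'"
      using U(2) U'(2) by blast
    \<comment> \<open>\<open>U\<close> and \<open>U'\<close> need not contain the unit, so they are
      shifted there, \<open>U\<close> by \<open>x\<close> on the right and \<open>U'\<close> by
      \<open>x'\<close> on the left. The shift is compensated by the free argument, chosen as
      \<open>- x + g\<close> and \<open>g + - x'\<close>.\<close>
    define V where "V = (\<lambda>v. v + x) -` U \<inter> (\<lambda>v. x' + v) -` U'"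
    have "open V"
      unfolding V_def by (intro open_Int open_vimage U(1) U'(1) continuous_intros)
    moreover have "0 \<in> V"
      using x by (simp add: V_def)
    moreover have "\<bar>apply_bcontfun f (v + g) - apply_bcontfun f g\<bar> \<le> \<epsilon> / 2" if "v \<in> V" for v g
    proof -
      have "(\<lambda>z. apply_bcontfun (translate f z) (- x + g)) \<in> L"
        unfolding L_def using evalB by (rule rev_image_eqI) simp
      from U(3)[OF this, of "v + x" x] show ?thesis
        using that x by (simp add: V_def translate.rep_eq add.assoc)
    qed
    moreover have "\<bar>apply_bcontfun f (g + v) - apply_bcontfun f g\<bar> \<le> \<epsilon> / 2" if "v \<in> V" for v g
      using U'(3)[OF imageI[OF orbit[of "g + - x'"]], of "x' + v" x'] that x
      by (simp add: V_def translate.rep_eq flip: add.assoc)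
    ultimately show "\<exists>V. open V \<and> 0 \<in> V \<and>
        (\<forall>v\<in>V. (SUP g. \<bar>apply_bcontfun f (v + g) - apply_bcontfun f g\<bar>) < \<epsilon> \<and>
               (SUP g. \<bar>apply_bcontfun f (g + v) - apply_bcontfun f g\<bar>) < \<epsilon>)"
      using e by (intro exI[of _ V] conjI ballI)
        (auto intro!: order_le_less_trans[OF cSUP_least[where M = "\<epsilon> / 2"]])
  qed
qed

section \<open>Permutations of \<open>\<nat>\<close>\<close>

lemma perm_apply_zero [simp]: "perm_apply 0 n = n"
  by (simp add: zero_nat_perm.rep_eq)

lemma perm_apply_plus [simp]: "perm_apply (g + h) n = perm_apply g (perm_apply h n)"
  by (simp add: plus_nat_perm.rep_eq)

lemma perm_apply_uminus_left [simp]: "perm_apply (- g) (perm_apply g n) = n"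
  by (metis add.left_inverse perm_apply_plus perm_apply_zero)

lemma perm_apply_uminus_right [simp]: "perm_apply g (perm_apply (- g) n) = n"
  by (metis add.right_inverse perm_apply_plus perm_apply_zero)

lemma perm_apply_minus [simp]: "perm_apply (g - h) n = perm_apply g (perm_apply (- h) n)"
  unfolding minus_nat_perm_def by (rule perm_apply_plus)

lemma perm_apply_eq_iff [simp]: "perm_apply g m = perm_apply g n \<longleftrightarrow> m = n"
  by (metis perm_apply_uminus_left)

lemma perm_apply_eq_iff_uminus: "perm_apply g m = n \<longleftrightarrow> m = perm_apply (- g) n"
  by (metis perm_apply_uminus_left perm_apply_uminus_right)

lemma nat_perm_eqI: "(\<And>n. perm_apply g n = perm_apply h n) \<Longrightarrow> g = h"
  by (rule perm_apply_inject[THEN iffD1], rule ext)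

lemma perm_apply_Abs: "bij \<pi> \<Longrightarrow> perm_apply (Abs_nat_perm \<pi>) = \<pi>"
  by (simp add: Abs_nat_perm_inverse)

lemma ex_nat_perm_extending:
  fixes f :: "nat \<Rightarrow> nat"
  assumes A: "finite A" and f: "inj_on f A"
  obtains g where "\<And>a. a \<in> A \<Longrightarrow> perm_apply g a = f a"
proof -
  define B where "B = A \<union> f ` A"
  have B: "finite B" "A \<subseteq> B" "f ` A \<subseteq> B"
    using A by (auto simp: B_def)
  have "card (B - A) = card (B - f ` A)"
    using A B by (simp add: card_Diff_subset card_image[OF f])
  then obtain r where r: "bij_betw r (B - A) (B - f ` A)"
    using finite_same_card_bij B(1) by (metis finite_Diff)
  define h where "h x = (if x \<in> A then f x else if x \<in> B then r x else x)" for x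
  have "bij_betw h A (f ` A)"
    using f by (auto simp: bij_betw_def h_def inj_on_def)
  moreover have "bij_betw h (B - A) (B - f ` A)"
    using r by (subst bij_betw_cong[of _ _ r]) (auto simp: h_def)
  ultimately have "bij_betw h (A \<union> (B - A)) (f ` A \<union> (B - f ` A))"
    by (rule bij_betw_combine) auto
  moreover have "bij_betw h (- B) (- B)"
    using B(2) by (subst bij_betw_cong[of _ _ id]) (auto simp: h_def)
  ultimately have "bij_betw h (A \<union> (B - A) \<union> - B) (f ` A \<union> (B - f ` A) \<union> - B)"
    by (rule bij_betw_combine) (use B in auto)
  moreover have "A \<union> (B - A) \<union> - B = UNIV" "f ` A \<union> (B - f ` A) \<union> - B = UNIV"
    by auto
  ultimately have "bij h"
    by simp
  then show thesis
    by (intro that[of "Abs_nat_perm h"]) (simp add: perm_apply_Abs h_def)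
qed

lemma continuous_on_perm_apply: "continuous_on S (\<lambda>g. perm_apply g n)"
proof -
  have "open ((\<lambda>g. perm_apply g n) -` B)" for B
    unfolding open_nat_perm_def
    by (intro exI[of _ "(\<lambda>a. a n) -` B"] conjI open_vimage continuous_on_product_coordinates)
      (auto simp: open_discrete)
  then have "continuous_on UNIV (\<lambda>g. perm_apply g n)"
    by (simp add: continuous_on_open_vimage)
  then show ?thesis
    by (rule continuous_on_subset[OF _ subset_UNIV])
qed

lemma continuous_on_perm_apply_uminus: "continuous_on S (\<lambda>g. perm_apply (- g) n)"
  by (rule continuous_on_compose2[OF continuous_on_perm_apply[of UNIV]]) (intro continuous_intros subset_UNIV)+

lemma open_perm_cylinder: "open {h. \<forall>i<n. perm_apply h i = p i}"
proof -
  have "{h. \<forall>i<n. perm_apply h i = p i} = (\<Inter>i\<in>{..<n}. (\<lambda>h. perm_apply h i) -` {p i})"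
    by auto
  also have "open \<dots>"
    by (intro open_INT finite_lessThan ballI open_vimage continuous_on_perm_apply open_discrete)
  finally show ?thesis .
qed

lemma open_contains_perm_cylinder:
  assumes "open U" "g \<in> U"
  obtains n where "\<And>h. (\<And>i. i < n \<Longrightarrow> perm_apply h i = perm_apply g i) \<Longrightarrow> h \<in> U"
proof -
  obtain V where V: "open V" "U = perm_apply -` V"
    using assms(1) by (auto simp: open_nat_perm_def)
  obtain I where I: "finite I" "\<And>y. (\<And>i. i \<in> I \<Longrightarrow> y i = perm_apply g i) \<Longrightarrow> y \<in> V"
    using open_contains_cylinder[OF V(1), of "perm_apply g"] assms(2) V(2) by auto
  obtain n where "I \<subseteq> {..<n}"
    using I(1) finite_nat_iff_bounded by blast
  with I(2) V(2) show thesis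
    by (intro that[of n]) auto
qed

section \<open>Separability and complete metrizability of the group\<close>

lemma countable_dense_nat_perm: "\<exists>D :: nat_perm set. countable D \<and> closure D = UNIV"
proof -
  \<comment> \<open>One permutation for each finite list of initial values. For a list with
    repetitions the choice is arbitrary, which affects neither countability nor density.\<close>
  define D where "D = range (\<lambda>xs. SOME g. map (perm_apply g) [0..<length xs] = xs)"
  have "closure D = UNIV"
  proof (rule equalityI[OF subset_UNIV], rule subsetI)
    fix g
    show "g \<in> closure D"
      unfolding closure_iff_nhds_not_empty
    proof (intro allI impI)
      fix A V
      assume "V \<subseteq> A" "open V" "g \<in> V"
      then obtain n where n: "\<And>h. (\<And>i. i < n \<Longrightarrow> perm_apply h i = perm_apply g i) \<Longrightarrow> h \<in> V"
        using open_contains_perm_cylinder by metis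
      define xs where "xs = map (perm_apply g) [0..<n]"
      define h where "h = (SOME h. map (perm_apply h) [0..<length xs] = xs)"
      have "map (perm_apply g) [0..<length xs] = xs"
        by (simp add: xs_def)
      then have "map (perm_apply h) [0..<length xs] = xs"
        unfolding h_def by (rule someI)
      then have "h \<in> V"
        by (intro n) (simp add: xs_def)
      then show "D \<inter> A \<noteq> {}"
        using \<open>V \<subseteq> A\<close> by (auto simp: D_def h_def)
    qed
  qed
  moreover have "countable D"
    by (simp add: D_def)
  ultimately show ?thesis
    by blast
qed

text \<open>A pointwise limit of permutations may fail to be surjective, so the values of
  \<open>g\<close> alone do not give a closed set. Recording \<open>g\<close> under
  \<open>Inl\<close> and \<open>- g\<close> under \<open>Inr\<close> does: each equation defining
  \<open>Z\<close> depends, locally, on two coordinates only.\<close>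

lemma completely_metrizable_nat_perm: "completely_metrizable_space (euclidean :: nat_perm topology)"
proof -
  define Z :: "(nat + nat \<Rightarrow> nat) set"
    where "Z = {a. \<forall>n. a (Inl (a (Inr n))) = n \<and> a (Inr (a (Inl n))) = n}"
  have *: "continuous_on UNIV (\<lambda>a :: nat + nat \<Rightarrow> nat. a (s (a t)))" for s t
  proof (rule continuous_on_cylinderI)
    fix a :: "nat + nat \<Rightarrow> nat" and U
    assume "a (s (a t)) \<in> U"
    then show "\<exists>I. finite I \<and> (\<forall>b\<in>UNIV. (\<forall>i\<in>I. b i = a i) \<longrightarrow> b (s (b t)) \<in> U)"
      by (intro exI[of _ "{t, s (a t)}"]) auto
  qed
  have "Z = (\<Inter>n. {a. a (Inl (a (Inr n))) = n}) \<inter> (\<Inter>n. {a. a (Inr (a (Inl n))) = n})"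
    by (auto simp: Z_def)
  also have "closed \<dots>"
    by (intro closed_Int closed_INT ballI closed_Collect_eq * continuous_on_const)
  finally have Z: "closed Z" .
  have "(euclidean :: nat topology) = discrete_topology UNIV"
    by (simp add: topology_eq open_discrete)
  then have "completely_metrizable_space (euclidean :: (nat + nat \<Rightarrow> nat) topology)"
    by (simp add: completely_metrizable_space_product_topology
        completely_metrizable_space_discrete_topology flip: euclidean_product_topology)
  then have cZ: "completely_metrizable_space (top_of_set Z)"
    using Z by (intro completely_metrizable_space_closedin) simp_all
  define j where "j g = case_sum (perm_apply g) (perm_apply (- g))" for g
  define k where "k a = Abs_nat_perm (\<lambda>n. a (Inl n))" for a :: "nat + nat \<Rightarrow> nat"
  have k: "perm_apply (k a) n = a (Inl n)" if a: "a \<in> Z" for a n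
  proof -
    have "bij (\<lambda>n. a (Inl n))"
      by (rule o_bij[of "\<lambda>n. a (Inr n)"]) (use a in \<open>auto simp: Z_def\<close>)
    then show ?thesis
      by (simp add: k_def perm_apply_Abs)
  qed
  have kj: "j (k a) = a" if a: "a \<in> Z" for a
  proof
    fix t
    have "perm_apply (- k a) n = a (Inr n)" for n
      using a k[OF a, of "a (Inr n)"] perm_apply_eq_iff_uminus[of "k a"] by (auto simp: Z_def)
    then show "j (k a) t = a t"
      using k[OF a] by (cases t) (auto simp: j_def)
  qed
  have j: "j g \<in> Z" for g
    by (simp add: j_def Z_def)
  then have jk: "k (j g) = g" for g
    by (intro nat_perm_eqI) (simp add: k j_def)
  have "continuous_on UNIV j"
  proof (rule continuous_on_coordinatewise_then_product)
    show "continuous_on UNIV (\<lambda>g. j g t)" for t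
      by (cases t) (auto simp: j_def continuous_on_perm_apply continuous_on_perm_apply_uminus)
  qed
  moreover have "continuous_on Z k"
  proof (rule continuous_on_cylinderI)
    fix a U
    assume a: "a \<in> Z" and U: "open U" "k a \<in> U"
    obtain n where n: "\<And>h. (\<And>i. i < n \<Longrightarrow> perm_apply h i = perm_apply (k a) i) \<Longrightarrow> h \<in> U"
      using open_contains_perm_cylinder[OF U] by blast
    have "k b \<in> U" if "b \<in> Z" "\<forall>i\<in>Inl ` {..<n}. b i = a i" for b
      using that by (intro n) (simp add: k a)
    then show "\<exists>I. finite I \<and> (\<forall>b\<in>Z. (\<forall>i\<in>I. b i = a i) \<longrightarrow> k b \<in> U)"
      by (intro exI[of _ "Inl ` {..<n}"]) simp
  qed
  ultimately have "homeomorphic_maps euclidean (top_of_set Z) j k"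
    using j jk kj by (auto simp: homeomorphic_maps_def continuous_map_in_subtopology)
  then have "(euclidean :: nat_perm topology) homeomorphic_space top_of_set Z"
    by (auto simp: homeomorphic_space_def)
  with cZ show ?thesis
    by (simp add: homeomorphic_completely_metrizable_space)
qed

lemma Baire_nat_perm:
  assumes "countable \<F>" "\<And>S. S \<in> \<F> \<Longrightarrow> closed S" "\<Union>\<F> = (UNIV :: nat_perm set)"
  shows "\<exists>S\<in>\<F>. interior S \<noteq> {}"
proof (rule ccontr)
  assume "\<not> (\<exists>S\<in>\<F>. interior S \<noteq> {})"
  then have "euclidean interior_of (\<Union>\<F>) = {}"
    using assms(1,2) by (intro Baire_category_alt disjI1 completely_metrizable_nat_perm) auto
  then show False
    using assms(3) by simp
qed

section \<open>Double cosets and 0-1 matrices\<close>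

definition perm_matrix :: "nat_perm \<Rightarrow> nat \<times> nat \<Rightarrow> bool" where
  "perm_matrix g = (\<lambda>(i, j). perm_apply g i = j)"

lemma perm_matrix_apply [simp]: "perm_matrix g (i, j) \<longleftrightarrow> perm_apply g i = j"
  by (simp add: perm_matrix_def)

text \<open>
  The pointwise stabilizers of the sets \<open>{0, \<dots>, n - 1}\<close> form a neighbourhood basis of the unit.
  Since \<open>w\<close> determines \<open>v\<close>, it suffices that \<open>w\<close> is the identity below \<open>n\<close> and maps the preimage
  under \<open>h\<close> of each \<open>j < n\<close> to its preimage under \<open>g\<close>.
\<close>

lemma double_coset_if_block_eq:
  assumes block: "\<And>i j. i < n \<Longrightarrow> j < n \<Longrightarrow> perm_apply g i = j \<longleftrightarrow> perm_apply h i = j"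
  shows "\<exists>v w. (\<forall>i<n. perm_apply v i = i) \<and> (\<forall>i<n. perm_apply w i = i) \<and> h = v + g + w"
proof -
  define q where "q x = (if x < n then x else perm_apply (- g) (perm_apply h x))" for x
  define A where "A = {..<n} \<union> perm_apply (- h) ` {..<n}"
  \<comment> \<open>The only collision to exclude is between a point \<open>x\<close> below
    \<open>n\<close>, which \<open>q\<close> keeps, and a preimage \<open>y\<close> under
    \<open>h\<close> of some \<open>j < n\<close>. It would give a one at \<open>(x, j)\<close> for
    \<open>g\<close>, hence for \<open>h\<close> by equality of blocks, so \<open>y\<close> would be
    \<open>x\<close>.\<close>
  have aux: "x = y" if xy: "x < n" "\<not> y < n" "y \<in> A" "x = perm_apply (- g) (perm_apply h y)" for x y
  proof -
    obtain j where j: "j < n" "y = perm_apply (- h) j"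
      using xy by (auto simp: A_def)
    then have "perm_apply g x = j"
      using xy by simp
    then have "perm_apply h x = j"
      using block xy(1) j(1) by blast
    then show ?thesis
      using j(2) perm_apply_eq_iff_uminus by blast
  qed
  have "inj_on q A"
  proof (rule inj_onI)
    fix x y
    assume xy: "x \<in> A" "y \<in> A" "q x = q y"
    consider "x < n" "y < n" | "\<not> x < n" "\<not> y < n" | "x < n" "\<not> y < n" | "y < n" "\<not> x < n"
      by blast
    then show "x = y"
    proof cases
      case 3
      show ?thesis
        by (rule aux) (use 3 xy in \<open>simp_all add: q_def\<close>)
    next
      case 4
      have "y = x"
        by (rule aux) (use 4 xy in \<open>simp_all add: q_def\<close>)
      then show ?thesis
        by simp
    qed (use xy in \<open>simp_all add: q_def\<close>)
  qed
  then obtain w where w: "\<And>a. a \<in> A \<Longrightarrow> perm_apply w a = q a"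
    using ex_nat_perm_extending[of A q] by (auto simp: A_def)
  define v where "v = h - w - g"
  have "perm_apply v j = j" if j: "j < n" for j
  proof -
    have "perm_apply w (perm_apply (- h) j) = perm_apply (- g) j"
    proof (cases "perm_apply (- h) j < n")
      case True
      then have "perm_apply g (perm_apply (- h) j) = j"
        using block j by simp
      then have "perm_apply (- h) j = perm_apply (- g) j"
        by (simp add: perm_apply_eq_iff_uminus)
      then show ?thesis
        using w[of "perm_apply (- h) j"] j True by (simp add: A_def q_def)
    next
      case False
      then show ?thesis
        using w[of "perm_apply (- h) j"] j by (simp add: A_def q_def)
    qed
    then have "perm_apply (- w) (perm_apply (- g) j) = perm_apply (- h) j"
      by (metis perm_apply_uminus_left)
    then show ?thesis
      by (simp add: v_def)
  qed
  moreover have "perm_apply w i = i" if "i < n" for i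
    using w[of i] that by (simp add: A_def q_def)
  moreover have "h = v + g + w"
    by (simp add: v_def)
  ultimately show ?thesis
    by blast
qed

text \<open>Boundedness of \<open>f\<close> makes the suprema in \<open>UC\<close> genuine upper
  bounds. The two index maps \<open>a\<close> and \<open>b\<close> cover translation on either
  side.\<close>

lemma abs_diff_le_SUP_translate:
  fixes f :: "'g::topological_space \<Rightarrow>\<^sub>C real" and a b :: "'i \<Rightarrow> 'g"
  shows "\<bar>apply_bcontfun f (a i) - apply_bcontfun f (b i)\<bar>
    \<le> (SUP i. \<bar>apply_bcontfun f (a i) - apply_bcontfun f (b i)\<bar>)"
proof (rule cSUP_upper)
  have "\<bar>apply_bcontfun f (a i) - apply_bcontfun f (b i)\<bar> \<le> norm f + norm f" for i
    using norm_bounded[of f "a i"] norm_bounded[of f "b i"] by simp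
  then show "bdd_above (range (\<lambda>i. \<bar>apply_bcontfun f (a i) - apply_bcontfun f (b i)\<bar>))"
    by (auto intro!: bdd_aboveI2)
qed simp

text \<open>Equal blocks put \<open>h\<close> into the form \<open>v + g + w\<close> with
  \<open>v\<close> and \<open>w\<close> small. Passing from \<open>g\<close> to \<open>g + w\<close>
  and on to \<open>v + (g + w)\<close> costs less than \<open>\<epsilon> / 2\<close> each
  time.\<close>

lemma UC_small_on_blocks:
  fixes f :: "nat_perm \<Rightarrow>\<^sub>C real"
  assumes "f \<in> UC" "\<epsilon> > 0"
  shows "\<exists>n. \<forall>g h. (\<forall>i<n. \<forall>j<n. perm_matrix g (i, j) = perm_matrix h (i, j)) \<longrightarrow>
    \<bar>apply_bcontfun f g - apply_bcontfun f h\<bar> < \<epsilon>"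
proof -
  have "\<epsilon> / 2 > 0"
    using assms(2) by simp
  then obtain V where V: "open V" "0 \<in> V"
      "\<And>v. v \<in> V \<Longrightarrow> (SUP g. \<bar>apply_bcontfun f (v + g) - apply_bcontfun f g\<bar>) < \<epsilon> / 2"
      "\<And>v. v \<in> V \<Longrightarrow> (SUP g. \<bar>apply_bcontfun f (g + v) - apply_bcontfun f g\<bar>) < \<epsilon> / 2"
    using assms(1) unfolding UC_def by blast
  obtain n where n: "\<And>h. (\<And>i. i < n \<Longrightarrow> perm_apply h i = i) \<Longrightarrow> h \<in> V"
    using open_contains_perm_cylinder[OF V(1,2)] by auto
  show ?thesis
  proof (intro exI[of _ n] allI impI)
    fix g h
    assume "\<forall>i<n. \<forall>j<n. perm_matrix g (i, j) = perm_matrix h (i, j)"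
    then obtain v w where "\<forall>i<n. perm_apply v i = i" "\<forall>i<n. perm_apply w i = i"
        and h: "h = v + g + w"
      using double_coset_if_block_eq[of n g h] by auto
    then have vw: "v \<in> V" "w \<in> V"
      using n by blast+
    have "\<bar>apply_bcontfun f (v + (g + w)) - apply_bcontfun f (g + w)\<bar> < \<epsilon> / 2"
      using abs_diff_le_SUP_translate[of f "\<lambda>g. v + g" "g + w" "\<lambda>g. g"] V(3)[OF vw(1)]
      by (rule order_le_less_trans)
    moreover have "\<bar>apply_bcontfun f (g + w) - apply_bcontfun f g\<bar> < \<epsilon> / 2"
      using abs_diff_le_SUP_translate[of f "\<lambda>g. g + w" g "\<lambda>g. g"] V(4)[OF vw(2)]
      by (rule order_le_less_trans)
    ultimately show "\<bar>apply_bcontfun f g - apply_bcontfun f h\<bar> < \<epsilon>"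
      unfolding h add.assoc by linarith
  qed
qed

section \<open>The closure of the permutation matrices and extension of functions to it\<close>

definition matrix_closure :: "(nat \<times> nat \<Rightarrow> bool) set" where
  "matrix_closure = closure (range perm_matrix)"

lemma perm_matrix_in_closure [simp]: "perm_matrix g \<in> matrix_closure"
  using closure_subset[of "range perm_matrix"] by (auto simp: matrix_closure_def)

lemma compact_matrix_closure: "compact matrix_closure"
  using compact_Int_closed[OF compact_UNIV_fun, of matrix_closure] by (simp add: matrix_closure_def)

lemma matrix_closure_approx:
  assumes "p \<in> matrix_closure" "finite I"
  obtains g where "\<And>i. i \<in> I \<Longrightarrow> perm_matrix g i = p i"
proof -
  have "range perm_matrix \<inter> {y. \<forall>i\<in>I. y i = p i} \<noteq> {}"
    using assms open_cylinder[OF assms(2), of p]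
    unfolding matrix_closure_def closure_iff_nhds_not_empty by blast
  then show thesis
    using that by auto
qed

text \<open>Two ones in a column would be shared by an approximating permutation, against
  injectivity. The absence of ones in a column involves infinitely many entries and can occur in the
  limit.\<close>

lemma matrix_closure_column_unique:
  assumes "p \<in> matrix_closure" "p (i, j)" "p (i', j)"
  shows "i = i'"
proof -
  obtain g where "\<And>x. x \<in> {(i, j), (i', j)} \<Longrightarrow> perm_matrix g x = p x"
    using matrix_closure_approx[OF assms(1), of "{(i, j), (i', j)}"] by blast
  then have "perm_apply g i = j" "perm_apply g i' = j"
    using assms(2,3) by (auto simp flip: perm_matrix_apply)
  then show ?thesis
    by (metis perm_apply_eq_iff)
qed

lemma continuous_on_perm_matrix: "continuous_on S perm_matrix"
proof (rule continuous_on_coordinatewise_then_product)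
  fix x :: "nat \<times> nat"
  have "continuous_on S ((\<lambda>m. m = snd x) \<circ> (\<lambda>g. perm_apply g (fst x)))"
    by (intro continuous_on_compose continuous_on_perm_apply continuous_on_discrete_topology)
  then show "continuous_on S (\<lambda>g. perm_matrix g x)"
    by (simp add: perm_matrix_def o_def split_beta)
qed

text \<open>The closure of the graph of \<open>f\<close> is the graph of the extension.\<close>

lemma UC_extension:
  fixes f :: "nat_perm \<Rightarrow>\<^sub>C real"
  assumes "f \<in> UC"
  shows "\<exists>F. continuous_on matrix_closure F \<and> (\<forall>g. apply_bcontfun f g = F (perm_matrix g))"
proof -
  define \<Gamma> where "\<Gamma> = closure (range (\<lambda>g. (perm_matrix g, apply_bcontfun f g)))"
  have c: "compact (UNIV \<times> cball 0 (norm f) :: ((nat \<times> nat \<Rightarrow> bool) \<times> real) set)"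
    by (intro compact_Times compact_UNIV_fun compact_cball)
  moreover have "\<Gamma> \<subseteq> UNIV \<times> cball 0 (norm f)"
    unfolding \<Gamma>_def
    by (rule closure_minimal[OF _ compact_imp_closed[OF c]]) (use norm_bounded[of f] in auto)
  ultimately have \<Gamma>: "compact \<Gamma>"
    using compact_Int_closed[OF c, of \<Gamma>] by (simp add: \<Gamma>_def Int_absorb1)
  have approx: "\<exists>g. (\<forall>i<n. \<forall>j<n. perm_matrix g (i, j) = p (i, j)) \<and> \<bar>apply_bcontfun f g - a\<bar> < \<epsilon>"
    if pa: "(p, a) \<in> \<Gamma>" "\<epsilon> > 0" for p a n \<epsilon>
  proof -
    let ?U = "{y. \<forall>i\<in>{..<n} \<times> {..<n}. y i = p i} \<times> {t. \<bar>t - a\<bar> < \<epsilon>}"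
    have "open ?U"
      by (intro open_Times open_cylinder open_Collect_less continuous_intros) auto
    then have "range (\<lambda>g. (perm_matrix g, apply_bcontfun f g)) \<inter> ?U \<noteq> {}"
      using pa unfolding \<Gamma>_def closure_iff_nhds_not_empty by fastforce
    then obtain g where "\<forall>x\<in>{..<n} \<times> {..<n}. perm_matrix g x = p x" "\<bar>apply_bcontfun f g - a\<bar> < \<epsilon>"
      by blast
    then show ?thesis
      by (intro exI[of _ g]) auto
  qed
  have "inj_on fst \<Gamma>"
  proof (rule inj_onI)
    fix x y
    assume xy: "x \<in> \<Gamma>" "y \<in> \<Gamma>" "fst x = fst y"
    have "snd x = snd y"
    proof (rule ccontr)
      assume "snd x \<noteq> snd y"
      \<comment> \<open>A third, for three errors: from \<open>snd x\<close> to \<open>f\<close> at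
        \<open>g\<close>, from there to \<open>f\<close> at \<open>h\<close>, and from there to
        \<open>snd y\<close>.\<close>
      define \<epsilon> where "\<epsilon> = \<bar>snd x - snd y\<bar> / 3"
      have e: "\<epsilon> > 0"
        using \<open>snd x \<noteq> snd y\<close> by (simp add: \<epsilon>_def)
      obtain n where n: "\<forall>g h. (\<forall>i<n. \<forall>j<n. perm_matrix g (i, j) = perm_matrix h (i, j)) \<longrightarrow>
          \<bar>apply_bcontfun f g - apply_bcontfun f h\<bar> < \<epsilon>"
        using UC_small_on_blocks[OF assms e] by blast
      obtain g where g: "\<forall>i<n. \<forall>j<n. perm_matrix g (i, j) = fst x (i, j)" "\<bar>apply_bcontfun f g - snd x\<bar> < \<epsilon>"
        using approx[of "fst x" "snd x" \<epsilon> n, unfolded prod.collapse, OF xy(1) e] by blast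
      obtain h where h: "\<forall>i<n. \<forall>j<n. perm_matrix h (i, j) = fst y (i, j)" "\<bar>apply_bcontfun f h - snd y\<bar> < \<epsilon>"
        using approx[of "fst y" "snd y" \<epsilon> n, unfolded prod.collapse, OF xy(2) e] by blast
      have "\<bar>apply_bcontfun f g - apply_bcontfun f h\<bar> < \<epsilon>"
        using g(1) h(1) xy(3) by (intro n[rule_format]) simp
      then have "\<bar>snd x - snd y\<bar> < 3 * \<epsilon>"
        using g(2) h(2) by linarith
      then show False
        by (simp add: \<epsilon>_def)
    qed
    with xy(3) show "x = y"
      by (simp add: prod_eq_iff)
  qed
  \<comment> \<open>The projection of the compact set \<open>\<Gamma>\<close> is a homeomorphism
    onto its image; its inverse followed by \<open>snd\<close> is the continuous extension.\<close>
  then obtain k where k: "homeomorphism \<Gamma> (fst ` \<Gamma>) fst k"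
    using homeomorphism_compact[OF \<Gamma> continuous_on_fst[OF continuous_on_id]] by blast
  have in\<Gamma>: "(perm_matrix g, apply_bcontfun f g) \<in> \<Gamma>" for g
    unfolding \<Gamma>_def by (rule subsetD[OF closure_subset]) simp
  have "closed (fst ` \<Gamma>)"
    by (intro compact_imp_closed compact_continuous_image \<Gamma> continuous_intros)
  moreover have "range perm_matrix \<subseteq> fst ` \<Gamma>"
    using in\<Gamma> by force
  ultimately have "matrix_closure \<subseteq> fst ` \<Gamma>"
    unfolding matrix_closure_def by (intro closure_minimal)
  then have "continuous_on matrix_closure (\<lambda>p. snd (k p))"
    using k by (intro continuous_on_snd) (auto simp: homeomorphism_def intro: continuous_on_subset)
  moreover have "apply_bcontfun f g = snd (k (perm_matrix g))" for g
    using homeomorphism_apply1[OF k in\<Gamma>[of g]] by simp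
  ultimately show ?thesis
    by (intro exI[of _ "\<lambda>p. snd (k p)"] conjI allI)
qed

text \<open>Uniform continuity on a compact set, with blocks in place of a metric. Having equal
  \<open>n\<close>-blocks is an equivalence relation, so a matrix that shares its block with
  \<open>p\<close> lies in the same set of the finite cover as \<open>p\<close>.\<close>

lemma continuous_small_on_blocks:
  fixes F :: "(nat \<times> nat \<Rightarrow> bool) \<Rightarrow> real"
  assumes K: "compact K" and F: "continuous_on K F" and "\<epsilon> > 0"
  shows "\<exists>n. \<forall>p\<in>K. \<forall>q\<in>K. (\<forall>i<n. \<forall>j<n. p (i, j) = q (i, j)) \<longrightarrow> \<bar>F p - F q\<bar> < \<epsilon>"
proof -
  define C where "C n p = {q. \<forall>x\<in>{..<n} \<times> {..<n}. q x = p x}" for n and p :: "nat \<times> nat \<Rightarrow> bool"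
  have "\<exists>n. \<forall>q\<in>K \<inter> C n p. \<bar>F q - F p\<bar> < \<epsilon> / 2" if p: "p \<in> K" for p
  proof -
    have "open {t. \<bar>t - F p\<bar> < \<epsilon> / 2}"
      by (intro open_Collect_less continuous_intros)
    moreover have "F p \<in> {t. \<bar>t - F p\<bar> < \<epsilon> / 2}"
      using \<open>\<epsilon> > 0\<close> by simp
    ultimately obtain A where A: "open A" "p \<in> A" "\<forall>q\<in>K. q \<in> A \<longrightarrow> F q \<in> {t. \<bar>t - F p\<bar> < \<epsilon> / 2}"
      using F p unfolding continuous_on_topological by meson
    obtain I where I: "finite I" "\<And>q. (\<And>i. i \<in> I \<Longrightarrow> q i = p i) \<Longrightarrow> q \<in> A"
      using open_contains_cylinder[OF A(1,2)] by blast
    have "finite (fst ` I \<union> snd ` I)"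
      using I(1) by simp
    then obtain n where "fst ` I \<union> snd ` I \<subseteq> {..<n}"
      using finite_nat_iff_bounded by blast
    then have "I \<subseteq> {..<n} \<times> {..<n}"
      by (auto intro: rev_image_eqI dest!: subsetD)
    then have "C n p \<subseteq> A"
      using I(2) unfolding C_def by blast
    then show ?thesis
      using A(3) by blast
  qed
  then obtain N where N: "\<And>p. p \<in> K \<Longrightarrow> \<forall>q\<in>K \<inter> C (N p) p. \<bar>F q - F p\<bar> < \<epsilon> / 2"
    by metis
  have "\<And>p. p \<in> K \<Longrightarrow> open (C (N p) p)"
    unfolding C_def by (rule open_cylinder) simp
  moreover have "K \<subseteq> (\<Union>p\<in>K. C (N p) p)"
    by (auto simp: C_def)
  ultimately obtain P where P: "P \<subseteq> K" "finite P" "K \<subseteq> (\<Union>p\<in>P. C (N p) p)"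
    by (rule compactE_image[OF K])
  define n where "n = Max (insert 0 (N ` P))"
  show ?thesis
  proof (intro exI[of _ n] ballI impI)
    fix p q
    assume pq: "p \<in> K" "q \<in> K" and eq: "\<forall>i<n. \<forall>j<n. p (i, j) = q (i, j)"
    obtain r where r: "r \<in> P" "p \<in> C (N r) r"
      using P(3) pq(1) by blast
    have "N r \<le> n"
      using P(2) r(1) by (simp add: n_def)
    then have "q \<in> C (N r) r"
      using r(2) eq by (auto simp: C_def)
    then have "\<bar>F q - F r\<bar> < \<epsilon> / 2" "\<bar>F p - F r\<bar> < \<epsilon> / 2"
      using N[of r] r P(1) pq by auto
    then show "\<bar>F p - F q\<bar> < \<epsilon>"
      by linarith
  qed
qed

text \<open>For the converse, let \<open>v\<close> fix all points below \<open>n\<close>. Then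
  \<open>v + g\<close> has the same columns below \<open>n\<close> as \<open>g\<close>, and
  \<open>g + v\<close> the same rows below \<open>n\<close>; either way the block is
  unchanged.\<close>

lemma UC_iff_extension:
  fixes f :: "nat_perm \<Rightarrow>\<^sub>C real"
  shows "f \<in> UC \<longleftrightarrow> (\<exists>F. continuous_on matrix_closure F \<and> (\<forall>g. apply_bcontfun f g = F (perm_matrix g)))"
    (is "_ \<longleftrightarrow> ?R")
proof
  assume "f \<in> UC"
  then show ?R
    by (rule UC_extension)
next
  assume ?R
  then obtain F where F: "continuous_on matrix_closure F" "\<And>g. apply_bcontfun f g = F (perm_matrix g)"
    by blast
  show "f \<in> UC"
    unfolding UC_def
  proof (intro CollectI allI impI)
    fix \<epsilon> :: real
    assume "\<epsilon> > 0"
    then have e: "\<epsilon> / 2 > 0"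
      by simp
    obtain n where n: "\<forall>p\<in>matrix_closure. \<forall>q\<in>matrix_closure.
        (\<forall>i<n. \<forall>j<n. p (i, j) = q (i, j)) \<longrightarrow> \<bar>F p - F q\<bar> < \<epsilon> / 2"
      using continuous_small_on_blocks[OF compact_matrix_closure F(1) e] by blast
    define V where "V = {v. \<forall>i<n. perm_apply v i = i}"
    have "\<bar>apply_bcontfun f (v + g) - apply_bcontfun f g\<bar> \<le> \<epsilon> / 2" if "v \<in> V" for v g
    proof -
      have "perm_apply v (perm_apply g i) = j \<longleftrightarrow> perm_apply g i = j" if "j < n" for i j
        using that \<open>v \<in> V\<close> perm_apply_eq_iff[of v _ j] by (simp add: V_def)
      then show ?thesis
        unfolding F(2) by (intro less_imp_le n[rule_format]) auto
    qed
    moreover have "\<bar>apply_bcontfun f (g + v) - apply_bcontfun f g\<bar> \<le> \<epsilon> / 2" if "v \<in> V" for v g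
      unfolding F(2) using that by (intro less_imp_le n[rule_format]) (auto simp: V_def)
    moreover have "open V"
      unfolding V_def by (rule open_perm_cylinder)
    moreover have "0 \<in> V"
      by (simp add: V_def)
    ultimately show "\<exists>V. open V \<and> 0 \<in> V \<and>
        (\<forall>v\<in>V. (SUP g. \<bar>apply_bcontfun f (v + g) - apply_bcontfun f g\<bar>) < \<epsilon> \<and>
               (SUP g. \<bar>apply_bcontfun f (g + v) - apply_bcontfun f g\<bar>) < \<epsilon>)"
      using e by (intro exI[of _ V] conjI ballI)
        (auto intro!: order_le_less_trans[OF cSUP_least[where M = "\<epsilon> / 2"]])
  qed
qed

section \<open>Uniformly continuous functions on \<open>S(\<nat>)\<close> are WAP\<close>

text \<open>One operation for both translations: \<open>x\<close> permutes rows, which is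
  multiplication on the right by \<open>x\<close>; \<open>y\<close> permutes columns, which is
  multiplication on the left by \<open>- y\<close>.\<close>

definition matrix_permute :: "nat_perm \<Rightarrow> nat_perm \<Rightarrow> (nat \<times> nat \<Rightarrow> bool) \<Rightarrow> nat \<times> nat \<Rightarrow> bool" where
  "matrix_permute x y p = (\<lambda>(i, j). p (perm_apply x i, perm_apply y j))"

lemma matrix_permute_apply [simp]:
  "matrix_permute x y p (i, j) = p (perm_apply x i, perm_apply y j)"
  by (simp add: matrix_permute_def)

lemma matrix_permute_perm_matrix: "matrix_permute x y (perm_matrix g) = perm_matrix (- y + g + x)"
  by (rule ext) (auto simp: matrix_permute_def perm_matrix_def)

lemma matrix_closureI:
  assumes "\<And>I. finite I \<Longrightarrow> \<exists>g. \<forall>i\<in>I. perm_matrix g i = p i"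
  shows "p \<in> matrix_closure"
proof (rule closed_if_cylinder_approximable)
  show "closed matrix_closure"
    by (simp add: matrix_closure_def)
  show "\<exists>y\<in>matrix_closure. \<forall>i\<in>I. y i = p i" if "finite I" for I
    using assms[OF that] by (auto intro!: bexI[of _ "perm_matrix _"])
qed

lemma matrix_permute_in_closure:
  assumes "p \<in> matrix_closure"
  shows "matrix_permute x y p \<in> matrix_closure"
proof (rule matrix_closureI)
  fix I :: "(nat \<times> nat) set"
  assume "finite I"
  then obtain g where g: "\<And>i. i \<in> map_prod (perm_apply x) (perm_apply y) ` I \<Longrightarrow> perm_matrix g i = p i"
    using matrix_closure_approx[OF assms finite_imageI] by blast
  have "perm_matrix (- y + g + x) i = matrix_permute x y p i" if "i \<in> I" for i
    using g[OF imageI[OF that]] unfolding matrix_permute_perm_matrix[symmetric]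
    by (simp add: matrix_permute_def split_beta map_prod_def)
  then show "\<exists>g. \<forall>i\<in>I. perm_matrix g i = matrix_permute x y p i"
    by blast
qed

lemma continuous_on_matrix_permute_left: "continuous_on S (\<lambda>x. matrix_permute x y p)"
proof (rule continuous_on_coordinatewise_then_product)
  fix i :: "nat \<times> nat"
  have "continuous_on S ((\<lambda>m. p (m, perm_apply y (snd i))) \<circ> (\<lambda>x. perm_apply x (fst i)))"
    by (intro continuous_on_compose continuous_on_perm_apply continuous_on_discrete_topology)
  then show "continuous_on S (\<lambda>x. matrix_permute x y p i)"
    by (simp add: matrix_permute_def o_def split_beta)
qed

text \<open>
  The matrix \<open>matrix_permute x 0 p\<close> is the product \<open>px\<close>. If \<open>F\<close> is continuous on \<open>matrix_closure\<close> and
  \<open>p\<close> belongs to it, the function is in \<open>bcontfun\<close>; outside \<open>bcontfun\<close>, \<open>Bcontfun\<close> is unspecified.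
\<close>

definition matrix_translate :: "((nat \<times> nat \<Rightarrow> bool) \<Rightarrow> real) \<Rightarrow> (nat \<times> nat \<Rightarrow> bool) \<Rightarrow> nat_perm \<Rightarrow>\<^sub>C real" where
  "matrix_translate F p = Bcontfun (\<lambda>x. F (matrix_permute x 0 p))"

lemma bounded_on_matrix_closure:
  assumes "continuous_on matrix_closure F"
  shows "bounded (F ` matrix_closure :: real set)"
  by (intro compact_imp_bounded compact_continuous_image assms compact_matrix_closure)

lemma apply_matrix_translate:
  assumes F: "continuous_on matrix_closure F" and p: "p \<in> matrix_closure"
  shows "apply_bcontfun (matrix_translate F p) x = F (matrix_permute x 0 p)"
proof -
  have "continuous_on UNIV (\<lambda>x. F (matrix_permute x 0 p))"
    by (rule continuous_on_compose2[OF F continuous_on_matrix_permute_left])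
      (use matrix_permute_in_closure[OF p] in auto)
  moreover have "bounded (range (\<lambda>x. F (matrix_permute x 0 p)))"
    by (rule bounded_subset[OF bounded_on_matrix_closure[OF F]])
      (use matrix_permute_in_closure[OF p] in auto)
  ultimately have "(\<lambda>x. F (matrix_permute x 0 p)) \<in> bcontfun"
    by (simp add: bcontfun_def)
  then show ?thesis
    by (simp add: matrix_translate_def Bcontfun_inverse)
qed

text \<open>With the signs of the values as coefficients, the sum becomes the value of
  \<open>\<phi>\<close> at a single function \<open>u\<close> of norm at most 1.\<close>

lemma sum_abs_blinfun_le:
  fixes \<phi> :: "('g::topological_space \<Rightarrow>\<^sub>C real) \<Rightarrow>\<^sub>L real"
  assumes "\<And>x. (\<Sum>t\<in>T. \<bar>apply_bcontfun (e t) x\<bar>) \<le> 1"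
  shows "(\<Sum>t\<in>T. \<bar>blinfun_apply \<phi> (e t)\<bar>) \<le> norm \<phi>"
proof -
  define u where "u = (\<Sum>t\<in>T. sgn (blinfun_apply \<phi> (e t)) *\<^sub>R e t)"
  have "norm u \<le> 1"
  proof (rule norm_bound)
    fix x
    interpret eval: bounded_linear "\<lambda>f :: 'g \<Rightarrow>\<^sub>C real. apply_bcontfun f x"
      by (rule bounded_linear_eval_bcontfun)
    have "norm (apply_bcontfun u x) \<le> (\<Sum>t\<in>T. \<bar>sgn (blinfun_apply \<phi> (e t)) * apply_bcontfun (e t) x\<bar>)"
      unfolding u_def eval.sum by (rule order_trans[OF norm_sum]) (simp add: eval.scaleR)
    also have "\<dots> \<le> (\<Sum>t\<in>T. \<bar>apply_bcontfun (e t) x\<bar>)"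
      by (rule sum_mono) (simp add: abs_mult abs_sgn_eq)
    finally show "norm (apply_bcontfun u x) \<le> 1"
      using assms[of x] by linarith
  qed
  have "(\<Sum>t\<in>T. \<bar>blinfun_apply \<phi> (e t)\<bar>) = blinfun_apply \<phi> u"
    by (simp add: u_def blinfun.sum_right blinfun.scaleR_right mult_sgn_abs abs_sgn mult.commute)
  also have "\<dots> \<le> norm \<phi> * norm u"
    using norm_blinfun[of \<phi> u] by simp
  also have "\<dots> \<le> norm \<phi> * 1"
    by (intro mult_left_mono \<open>norm u \<le> 1\<close>) simp
  finally show ?thesis
    by simp
qed

text \<open>This is weak convergence to 0 along the family: \<open>n\<close> values of size at least
  \<open>\<epsilon>\<close> would force \<open>n * \<epsilon> \<le> norm \<phi>\<close>.\<close>

lemma finite_large_blinfun_values: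
  fixes \<phi> :: "('g::topological_space \<Rightarrow>\<^sub>C real) \<Rightarrow>\<^sub>L real"
  assumes "\<And>T x. finite T \<Longrightarrow> T \<subseteq> A \<Longrightarrow> (\<Sum>t\<in>T. \<bar>apply_bcontfun (e t) x\<bar>) \<le> 1" and "\<epsilon> > 0"
  shows "finite {t\<in>A. \<epsilon> \<le> \<bar>blinfun_apply \<phi> (e t)\<bar>}"
proof (rule ccontr)
  assume inf: "infinite {t\<in>A. \<epsilon> \<le> \<bar>blinfun_apply \<phi> (e t)\<bar>}"
  obtain n :: nat where n: "norm \<phi> / \<epsilon> < real n"
    using reals_Archimedean2 by blast
  obtain T where T: "finite T" "card T = n" "T \<subseteq> {t\<in>A. \<epsilon> \<le> \<bar>blinfun_apply \<phi> (e t)\<bar>}"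
    using infinite_arbitrarily_large[OF inf] by blast
  have "real n * \<epsilon> = (\<Sum>t\<in>T. \<epsilon>)"
    using T(2) by simp
  also have "\<dots> \<le> (\<Sum>t\<in>T. \<bar>blinfun_apply \<phi> (e t)\<bar>)"
    by (rule sum_mono) (use T(3) in auto)
  also have "\<dots> \<le> norm \<phi>"
    using T by (intro sum_abs_blinfun_le assms(1)) auto
  finally show False
    using n \<open>\<epsilon> > 0\<close> by (simp add: field_simps)
qed

lemma continuous_on_monomial:
  assumes "finite s"
  shows "continuous_on S (\<lambda>p :: 'i \<Rightarrow> bool. of_bool (\<forall>i\<in>s. p i) :: real)"
proof (rule continuous_on_cylinder_realI)
  fix p :: "'i \<Rightarrow> bool" and \<epsilon> :: real
  assume "\<epsilon> > 0"
  then show "\<exists>I. finite I \<and> (\<forall>q\<in>S. (\<forall>i\<in>I. q i = p i) \<longrightarrow>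
      \<bar>of_bool (\<forall>i\<in>s. q i) - of_bool (\<forall>i\<in>s. p i)\<bar> < \<epsilon>)"
    using assms by (intro exI[of _ s]) auto
qed

text \<open>
  The translates of a monomial by matrices are \<open>0\<close> or indicator functions of pairwise disjoint
  sets; a bounded functional is small on all but finitely many of the latter.
\<close>

lemma weakly_continuous_translate_monomial:
  fixes \<phi> :: "(nat_perm \<Rightarrow>\<^sub>C real) \<Rightarrow>\<^sub>L real"
  assumes s: "finite s"
  shows "continuous_on matrix_closure
    (\<lambda>p. blinfun_apply \<phi> (matrix_translate (\<lambda>p. of_bool (\<forall>i\<in>s. p i)) p))"
proof -
  define W where "W = matrix_translate (\<lambda>p. of_bool (\<forall>i\<in>s. p i))"
  have W: "apply_bcontfun (W p) x = of_bool (\<forall>(i, j)\<in>s. p (perm_apply x i, j))"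
    if "p \<in> matrix_closure" for p x
    by (simp add: W_def apply_matrix_translate[OF continuous_on_monomial[OF s] that]
        matrix_permute_def split_beta)
  define J where "J = snd ` s"
  have J: "finite J"
    using s by (simp add: J_def)
  \<comment> \<open>\<open>k\<close> selects, for each column in \<open>J\<close>, the row holding
    its one. Restricting to \<open>k \<in> extensional J\<close> fixes the irrelevant values outside
    \<open>J\<close>, so that distinct \<open>k\<close> give disjoint sets.\<close>
  define e where "e k = Bcontfun (\<lambda>x. of_bool (\<forall>(i, j)\<in>s. perm_apply x i = k j) :: real)" for k
  have e: "apply_bcontfun (e k) x = of_bool (\<forall>(i, j)\<in>s. perm_apply x i = k j)" for k x
  proof -
    have "continuous_on UNIV ((\<lambda>p. of_bool (\<forall>i\<in>(\<lambda>(i, j). (i, k j)) ` s. p i) :: real) \<circ> perm_matrix)"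
      using s by (intro continuous_on_compose continuous_on_monomial continuous_on_perm_matrix) simp
    then have "continuous_on UNIV (\<lambda>x. of_bool (\<forall>(i, j)\<in>s. perm_apply x i = k j) :: real)"
      by (simp add: o_def split_beta)
    then have "(\<lambda>x. of_bool (\<forall>(i, j)\<in>s. perm_apply x i = k j) :: real) \<in> bcontfun"
      by (rule bcontfun_normI[where b=1]) simp
    then show ?thesis
      by (simp add: e_def Bcontfun_inverse)
  qed
  have disjoint: "k = k'" if kk': "k \<in> extensional J" "k' \<in> extensional J"
    "\<forall>(i, j)\<in>s. perm_apply x i = k j" "\<forall>(i, j)\<in>s. perm_apply x i = k' j" for k k' x
  proof (rule extensionalityI[OF kk'(1,2)])
    fix j
    assume "j \<in> J"
    then obtain i where "(i, j) \<in> s"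
      by (auto simp: J_def)
    then show "k j = k' j"
      using kk'(3,4) by fastforce
  qed
  have sum_le: "(\<Sum>k\<in>T. \<bar>apply_bcontfun (e k) x\<bar>) \<le> 1" if T: "finite T" "T \<subseteq> extensional J" for T x
  proof (cases "\<exists>k\<in>T. \<forall>(i, j)\<in>s. perm_apply x i = k j")
    case True
    then obtain k where k: "k \<in> T" "\<forall>(i, j)\<in>s. perm_apply x i = k j"
      by blast
    have "(\<Sum>l\<in>T - {k}. \<bar>apply_bcontfun (e l) x\<bar>) = 0"
    proof (rule sum.neutral, rule ballI)
      fix l
      assume "l \<in> T - {k}"
      then have "\<not> (\<forall>(i, j)\<in>s. perm_apply x i = l j)"
        using disjoint[of l k x] k T(2) by blast
      then show "\<bar>apply_bcontfun (e l) x\<bar> = 0"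
        unfolding e by simp
    qed
    moreover have "\<bar>apply_bcontfun (e k) x\<bar> \<le> 1"
      unfolding e by simp
    ultimately show ?thesis
      using sum.remove[OF T(1) k(1), of "\<lambda>k. \<bar>apply_bcontfun (e k) x\<bar>"] by simp
  next
    case False
    have "(\<Sum>k\<in>T. \<bar>apply_bcontfun (e k) x\<bar>) = 0"
    proof (rule sum.neutral, rule ballI)
      fix k
      assume "k \<in> T"
      then have "\<not> (\<forall>(i, j)\<in>s. perm_apply x i = k j)"
        using False by blast
      then show "\<bar>apply_bcontfun (e k) x\<bar> = 0"
        unfolding e by simp
    qed
    then show ?thesis
      by simp
  qed
  have W_eq_e: "W p = e k" if p: "p \<in> matrix_closure" and k: "\<forall>j\<in>J. p (k j, j)" for p k
  proof (rule bcontfun_eqI)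
    fix x
    have "p (perm_apply x i, j) \<longleftrightarrow> perm_apply x i = k j" if "(i, j) \<in> s" for i j
    proof -
      have "p (k j, j)"
        using k that by (force simp: J_def)
      then show ?thesis
        using matrix_closure_column_unique[OF p, of "perm_apply x i" j "k j"] by auto
    qed
    then have "(\<forall>(i, j)\<in>s. p (perm_apply x i, j)) \<longleftrightarrow> (\<forall>(i, j)\<in>s. perm_apply x i = k j)"
      by blast
    then show "apply_bcontfun (W p) x = apply_bcontfun (e k) x"
      unfolding W[OF p] e by simp
  qed
  have W_eq_0: "W p = 0" if p: "p \<in> matrix_closure" and j: "j \<in> J" "\<forall>i. \<not> p (i, j)" for p j
  proof (rule bcontfun_eqI)
    fix x
    obtain i where "(i, j) \<in> s"
      using j(1) by (auto simp: J_def)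
    then have "\<not> (\<forall>(i, j)\<in>s. p (perm_apply x i, j))"
      using j(2) by blast
    then show "apply_bcontfun (W p) x = apply_bcontfun 0 x"
      unfolding W[OF p] by (simp add: zero_bcontfun.rep_eq)
  qed
  have dich: "(\<exists>k\<in>extensional J. \<forall>j\<in>J. p (k j, j)) \<or> (\<exists>j\<in>J. \<forall>i. \<not> p (i, j))" for p
  proof (cases "\<exists>j\<in>J. \<forall>i. \<not> p (i, j)")
    case False
    then have "\<forall>j\<in>J. p (SOME i. p (i, j), j)"
      by (auto intro: someI)
    then have "\<forall>j\<in>J. p (restrict (\<lambda>j. SOME i. p (i, j)) J j, j)"
      by simp
    then show ?thesis
      using restrict_extensional by blast
  qed simp
  have "continuous_on matrix_closure (\<lambda>p. blinfun_apply \<phi> (W p))"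
  proof (rule continuous_on_cylinder_realI)
    fix p :: "nat \<times> nat \<Rightarrow> bool" and \<epsilon> :: real
    assume p: "p \<in> matrix_closure" and "\<epsilon> > 0"
    \<comment> \<open>The finitely many selections on which \<open>\<phi>\<close> is large. If
      column \<open>j\<close> of \<open>p\<close> is zero, matrices \<open>q\<close> near
      \<open>p\<close> have no one at \<open>(k j, j)\<close> for \<open>k \<in> B\<close>; so
      \<open>W q\<close> is 0 or some \<open>e k\<close> with \<open>k \<notin> B\<close>, while
      \<open>W p = 0\<close>.\<close>
    define B where "B = {k \<in> extensional J. \<epsilon> \<le> \<bar>blinfun_apply \<phi> (e k)\<bar>}"
    have B: "finite B"
      unfolding B_def by (rule finite_large_blinfun_values[OF sum_le \<open>\<epsilon> > 0\<close>])
    consider k where "k \<in> extensional J" "\<forall>j\<in>J. p (k j, j)" | j where "j \<in> J" "\<forall>i. \<not> p (i, j)"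
      using dich by blast
    then show "\<exists>I. finite I \<and> (\<forall>q\<in>matrix_closure. (\<forall>i\<in>I. q i = p i) \<longrightarrow>
        \<bar>blinfun_apply \<phi> (W q) - blinfun_apply \<phi> (W p)\<bar> < \<epsilon>)"
    proof cases
      case 1
      \<comment> \<open>Every column in \<open>J\<close> has a one, and these finitely many entries
        determine the translate, so \<open>W\<close> is locally constant at
        \<open>p\<close>.\<close>
      have "W q = W p" if "q \<in> matrix_closure" "\<forall>i\<in>(\<lambda>j. (k j, j)) ` J. q i = p i" for q
        using W_eq_e[OF that(1), of k] W_eq_e[OF p, of k] 1(2) that(2) by simp
      then show ?thesis
        using J \<open>\<epsilon> > 0\<close> by (intro exI[of _ "(\<lambda>j. (k j, j)) ` J"]) simp
    next
      case 2
      have "\<bar>blinfun_apply \<phi> (W q)\<bar> < \<epsilon>"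
        if q: "q \<in> matrix_closure" "\<forall>i\<in>(\<lambda>k. (k j, j)) ` B. q i = p i" for q
        using dich[of q]
      proof
        assume "\<exists>k\<in>extensional J. \<forall>j\<in>J. q (k j, j)"
        then obtain k where k: "k \<in> extensional J" "\<forall>j\<in>J. q (k j, j)"
          by blast
        have "q (k j, j)" "\<not> p (k j, j)"
          using k 2 by auto
        then have "k \<notin> B"
          using q(2) by blast
        then show ?thesis
          using k W_eq_e[OF q(1) k(2)] by (simp add: B_def)
      next
        assume "\<exists>j\<in>J. \<forall>i. \<not> q (i, j)"
        then show ?thesis
          using W_eq_0[OF q(1)] \<open>\<epsilon> > 0\<close> by auto
      qed
      moreover have "W p = 0"
        using W_eq_0[OF p] 2 by blast
      ultimately show ?thesis
        using B by (intro exI[of _ "(\<lambda>k. (k j, j)) ` B"]) simp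
    qed
  qed
  then show ?thesis
    by (simp add: W_def)
qed

text \<open>The polynomials in the matrix entries. As entries are 0 or 1, the product of two
  monomials is the monomial of the union of the index sets, so linear combinations already form an
  algebra; the empty index set gives the constants.\<close>

inductive_set monomial_span :: "(('i \<Rightarrow> bool) \<Rightarrow> real) set" where
  monomial: "finite s \<Longrightarrow> (\<lambda>p. of_bool (\<forall>i\<in>s. p i)) \<in> monomial_span"
| add: "F \<in> monomial_span \<Longrightarrow> G \<in> monomial_span \<Longrightarrow> (\<lambda>p. F p + G p) \<in> monomial_span"
| scale: "F \<in> monomial_span \<Longrightarrow> (\<lambda>p. c * F p) \<in> monomial_span"

lemma monomial_span_mult:
  assumes "F \<in> monomial_span" "G \<in> monomial_span"
  shows "(\<lambda>p. F p * G p) \<in> monomial_span"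
  using assms(1)
proof induction
  case (monomial s)
  show ?case
    using assms(2)
  proof induction
    case (monomial t)
    have "(\<lambda>p. of_bool (\<forall>i\<in>s. p i) * of_bool (\<forall>i\<in>t. p i)) = (\<lambda>p. of_bool (\<forall>i\<in>s \<union> t. p i) :: real)"
      by (rule ext) (simp add: ball_Un of_bool_conj)
    then show ?case
      using monomial_span.monomial[of "s \<union> t"] \<open>finite s\<close> monomial by simp
  next
    case (add F G)
    then show ?case
      using monomial_span.add by (fastforce simp: algebra_simps)
  next
    case (scale F c)
    then show ?case
      using monomial_span.scale[of _ c] by (fastforce simp: algebra_simps)
  qed
next
  case (add F G)
  then show ?case
    using monomial_span.add by (fastforce simp: algebra_simps)
next
  case (scale F c)
  then show ?case
    using monomial_span.scale[of _ c] by (fastforce simp: algebra_simps)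
qed

lemma continuous_on_monomial_span: "F \<in> monomial_span \<Longrightarrow> continuous_on S F"
  by (induction rule: monomial_span.induct) (auto intro!: continuous_on_monomial continuous_intros)

lemma monomial_span_ring:
  fixes K :: "('i \<Rightarrow> bool) set"
  assumes "compact K"
  shows "function_ring_on monomial_span K"
proof
  fix c :: real
  show "(\<lambda>_ :: 'i \<Rightarrow> bool. c) \<in> monomial_span"
    using monomial_span.scale[OF monomial_span.monomial[of "{} :: 'i set"], of c] by simp
next
  fix p q :: "'i \<Rightarrow> bool"
  assume "p \<noteq> q"
  then obtain i where "p i \<noteq> q i"
    by (auto simp: fun_eq_iff)
  then show "\<exists>F\<in>monomial_span. F p \<noteq> F q"
    using monomial_span.monomial[of "{i}"] by (intro bexI[of _ "\<lambda>p. of_bool (\<forall>i\<in>{i}. p i)"]) auto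
qed (auto intro: assms monomial_span.add monomial_span_mult continuous_on_monomial_span)

lemma norm_matrix_translate_diff:
  assumes F: "continuous_on matrix_closure F" and G: "continuous_on matrix_closure G"
    and p: "p \<in> matrix_closure" and le: "\<And>q. q \<in> matrix_closure \<Longrightarrow> \<bar>F q - G q\<bar> \<le> \<epsilon>"
  shows "norm (matrix_translate F p - matrix_translate G p) \<le> \<epsilon>"
proof (rule norm_bound)
  show "norm (apply_bcontfun (matrix_translate F p - matrix_translate G p) x) \<le> \<epsilon>" for x
    using le[OF matrix_permute_in_closure[OF p]]
    by (simp add: minus_bcontfun.rep_eq apply_matrix_translate[OF F p] apply_matrix_translate[OF G p])
qed

text \<open>For each \<open>p\<close> the translate is linear and norm-decreasing in
  \<open>F\<close>, uniformly in \<open>p\<close>. So uniform approximation of \<open>F\<close> by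
  polynomials gives uniform approximation of the scalar functions of \<open>p\<close>.\<close>

lemma weakly_continuous_matrix_translate:
  fixes \<phi> :: "(nat_perm \<Rightarrow>\<^sub>C real) \<Rightarrow>\<^sub>L real"
  assumes F: "continuous_on matrix_closure F"
  shows "continuous_on matrix_closure (\<lambda>p. blinfun_apply \<phi> (matrix_translate F p))"
proof -
  have span: "continuous_on matrix_closure (\<lambda>p. blinfun_apply \<phi> (matrix_translate G p))"
    if "G \<in> monomial_span" for G
    using that
  proof induction
    case (monomial s)
    then show ?case
      by (rule weakly_continuous_translate_monomial)
  next
    case (add G H)
    have "matrix_translate (\<lambda>p. G p + H p) p = matrix_translate G p + matrix_translate H p"
      if "p \<in> matrix_closure" for p
      using add.hyps
      by (intro bcontfun_eqI) (simp add: plus_bcontfun.rep_eq apply_matrix_translate[OF _ that]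
          continuous_on_monomial_span continuous_on_add)
    then show ?case
      using continuous_on_add[OF add.IH] by (simp add: blinfun.add_right cong: continuous_on_cong)
  next
    case (scale G c)
    have "matrix_translate (\<lambda>p. c * G p) p = c *\<^sub>R matrix_translate G p"
      if "p \<in> matrix_closure" for p
      using scale.hyps
      by (intro bcontfun_eqI) (simp add: scaleR_bcontfun.rep_eq apply_matrix_translate[OF _ that]
          continuous_on_monomial_span continuous_on_mult)
    then show ?case
      using continuous_on_mult_left[OF scale.IH, of c]
      by (simp add: blinfun.scaleR_right cong: continuous_on_cong)
  qed
  interpret function_ring_on monomial_span matrix_closure
    by (rule monomial_span_ring[OF compact_matrix_closure])
  obtain G where G: "\<And>n :: nat. G n \<in> monomial_span" "uniform_limit matrix_closure G F sequentially"
    using Stone_Weierstrass[OF F] by auto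
  have "uniform_limit matrix_closure (\<lambda>n p. blinfun_apply \<phi> (matrix_translate (G n) p))
      (\<lambda>p. blinfun_apply \<phi> (matrix_translate F p)) sequentially"
  proof (rule uniform_limitI)
    fix \<epsilon> :: real
    assume "\<epsilon> > 0"
    \<comment> \<open>The added 1 allows \<open>\<phi> = 0\<close> and makes
      \<open>norm \<phi> * \<delta> < \<epsilon>\<close> strict.\<close>
    define \<delta> where "\<delta> = \<epsilon> / (norm \<phi> + 1)"
    have \<delta>: "\<delta> > 0" "norm \<phi> * \<delta> < \<epsilon>"
      using \<open>\<epsilon> > 0\<close> by (auto simp: \<delta>_def field_simps add_pos_nonneg add_nonneg_pos)
    from uniform_limitD[OF G(2) \<delta>(1)]
    show "\<forall>\<^sub>F n in sequentially. \<forall>p\<in>matrix_closure.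
        dist (blinfun_apply \<phi> (matrix_translate (G n) p)) (blinfun_apply \<phi> (matrix_translate F p)) < \<epsilon>"
    proof (rule eventually_mono, intro ballI)
      fix n p
      assume n: "\<forall>q\<in>matrix_closure. dist (G n q) (F q) < \<delta>" and p: "p \<in> matrix_closure"
      have "norm (matrix_translate (G n) p - matrix_translate F p) \<le> \<delta>"
        using n by (intro norm_matrix_translate_diff continuous_on_monomial_span G F p)
          (auto simp: dist_real_def intro: less_imp_le)
      then have "norm \<phi> * norm (matrix_translate (G n) p - matrix_translate F p) \<le> norm \<phi> * \<delta>"
        by (rule mult_left_mono) simp
      then show "dist (blinfun_apply \<phi> (matrix_translate (G n) p)) (blinfun_apply \<phi> (matrix_translate F p)) < \<epsilon>"
        using norm_blinfun[of \<phi> "matrix_translate (G n) p - matrix_translate F p"] \<delta>(2)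
        by (simp add: dist_real_def blinfun.diff_right)
    qed
  qed
  then show ?thesis
    using span G(1) by (intro uniform_limit_theorem[where F = sequentially]) auto
qed

theorem UC_subset_WAP_nat_perm: "(UC :: (nat_perm \<Rightarrow>\<^sub>C real) set) \<subseteq> WAP"
proof
  fix f :: "nat_perm \<Rightarrow>\<^sub>C real"
  assume "f \<in> UC"
  then obtain F where F: "continuous_on matrix_closure F" "\<And>g. apply_bcontfun f g = F (perm_matrix g)"
    using UC_extension by blast
  have "continuous_map (top_of_set matrix_closure) weak_topology (matrix_translate F)"
    using weakly_continuous_matrix_translate[OF F(1)] by (simp add: continuous_map_weak_topology_iff)
  then have "compactin weak_topology (matrix_translate F ` matrix_closure)"
    using compact_matrix_closure by (intro image_compactin) (simp_all add: compactin_subtopology)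
  moreover have "translate f g = matrix_translate F (perm_matrix g)" for g
    by (rule bcontfun_eqI) (simp add: translate.rep_eq F(2) apply_matrix_translate[OF F(1)]
        matrix_permute_perm_matrix)
  then have "range (translate f) \<subseteq> matrix_translate F ` matrix_closure"
    by auto
  ultimately show "f \<in> WAP"
    unfolding WAP_def by (auto intro: relatively_weakly_compactI)
qed

theorem UC_eq_WAP_nat_perm: "(UC :: (nat_perm \<Rightarrow>\<^sub>C real) set) = WAP"
proof -
  obtain D :: "nat_perm set" where "countable D" "closure D = UNIV"
    using countable_dense_nat_perm by blast
  then have "(WAP :: (nat_perm \<Rightarrow>\<^sub>C real) set) \<subseteq> UC"
    by (intro WAP_subset_UC Baire_nat_perm)
  then show ?thesis
    using UC_subset_WAP_nat_perm by blast
qed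

section \<open>Compact \<open>G\<close>-spaces\<close>

text \<open>The action on \<open>Y\<close> is conjugate to that on \<open>X\<close>, so all
  requirements on \<open>Y\<close> are inherited. Hence only the matrix space has to be verified to
  be a compact \<open>G\<close>-space.\<close>

lemma isomorphic_compact_G_spacesI:
  fixes act :: "'g::topological_group_add \<Rightarrow> 'x \<Rightarrow> 'x"
  assumes X: "compact_G_space X act" and \<Phi>: "homeomorphic_map X Y \<Phi>"
    and equiv: "\<And>g x. x \<in> topspace X \<Longrightarrow> \<Phi> (act g x) = act' g (\<Phi> x)"
  shows "isomorphic_compact_G_spaces X act Y act'"
proof -
  obtain \<Psi> where m: "homeomorphic_maps X Y \<Phi> \<Psi>"
    using \<Phi> by (auto simp: homeomorphic_map_maps)
  then have \<Phi>c: "continuous_map X Y \<Phi>" and \<Psi>c: "continuous_map Y X \<Psi>"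
    and inv: "\<And>y. y \<in> topspace Y \<Longrightarrow> \<Phi> (\<Psi> y) = y"
    by (auto simp: homeomorphic_maps_def)
  have \<Psi>: "\<Psi> y \<in> topspace X" if "y \<in> topspace Y" for y
    using \<Psi>c that by (auto simp: continuous_map_def)
  have XY: "X homeomorphic_space Y"
    using m by (auto simp: homeomorphic_space_def)
  have cont: "continuous_map (prod_topology euclidean X) X (\<lambda>(g, x). act g x)"
    using X by (simp add: compact_G_space_def)
  have act_in: "act g x \<in> topspace X" if "x \<in> topspace X" for g x
    using continuous_map_image_subset_topspace[OF cont] that by (auto simp: image_subset_iff)
  have act': "act' g y = \<Phi> (act g (\<Psi> y))" if "y \<in> topspace Y" for g y
    using equiv[OF \<Psi>[OF that]] inv[OF that] by simp
  have "compact_G_space Y act'"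
    unfolding compact_G_space_def
  proof (intro conjI ballI allI)
    show "compact_space Y"
      using X homeomorphic_compact_space[OF XY] by (simp add: compact_G_space_def)
    show "Hausdorff_space Y"
      using X homeomorphic_Hausdorff_space[OF XY] by (simp add: compact_G_space_def)
    have "continuous_map (prod_topology euclidean Y) (prod_topology euclidean X) (\<lambda>z. (fst z, \<Psi> (snd z)))"
      by (intro continuous_map_pairedI continuous_map_fst
          continuous_map_compose[OF continuous_map_snd \<Psi>c, unfolded o_def])
    from continuous_map_compose[OF continuous_map_compose[OF this cont] \<Phi>c]
    show "continuous_map (prod_topology euclidean Y) Y (\<lambda>(g, y). act' g y)"
      by (rule continuous_map_eq) (auto simp: act')
    show "act' 0 y = y" if "y \<in> topspace Y" for y
      using X \<Psi>[OF that] inv[OF that] act'[OF that] by (simp add: compact_G_space_def)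
    show "act' (g + h) y = act' g (act' h y)" if "y \<in> topspace Y" for g h y
      using X equiv[OF act_in[OF \<Psi>[OF that]], of g h] act'[OF that] \<Psi>[OF that]
      by (simp add: compact_G_space_def)
  qed
  with X \<Phi> equiv show ?thesis
    unfolding isomorphic_compact_G_spaces_def by blast
qed

lemma isomorphic_compact_G_spaces_sym:
  assumes "isomorphic_compact_G_spaces X act Y act'"
  shows "isomorphic_compact_G_spaces Y act' X act"
proof -
  obtain \<Phi> where \<Phi>: "homeomorphic_map X Y \<Phi>" "\<And>g x. x \<in> topspace X \<Longrightarrow> \<Phi> (act g x) = act' g (\<Phi> x)"
    and G: "compact_G_space X act" "compact_G_space Y act'"
    using assms unfolding isomorphic_compact_G_spaces_def by blast
  obtain \<Psi> where m: "homeomorphic_maps X Y \<Phi> \<Psi>"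
    using \<Phi>(1) by (auto simp: homeomorphic_map_maps)
  show ?thesis
  proof (rule isomorphic_compact_G_spacesI[OF G(2)])
    show "homeomorphic_map Y X \<Psi>"
      using m homeomorphic_maps_sym unfolding homeomorphic_map_maps by blast
    fix g y
    assume y: "y \<in> topspace Y"
    then have \<Psi>: "\<Psi> y \<in> topspace X" "\<Phi> (\<Psi> y) = y"
      using m by (auto simp: homeomorphic_maps_def continuous_map_def)
    have "continuous_map (prod_topology euclidean X) X (\<lambda>(g, x). act g x)"
      using G(1) by (simp add: compact_G_space_def)
    then have "act g (\<Psi> y) \<in> topspace X"
      using continuous_map_image_subset_topspace \<Psi>(1) by (fastforce simp: image_subset_iff)
    then have "\<Psi> (\<Phi> (act g (\<Psi> y))) = act g (\<Psi> y)"
      using m by (simp add: homeomorphic_maps_def)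
    then show "\<Psi> (act' g y) = act g (\<Psi> y)"
      using \<Phi>(2)[OF \<Psi>(1), of g] \<Psi>(2) by simp
  qed
qed

lemma isomorphic_compact_G_spaces_trans:
  assumes "isomorphic_compact_G_spaces X act Y act'" "isomorphic_compact_G_spaces Y act' Z act''"
  shows "isomorphic_compact_G_spaces X act Z act''"
proof -
  obtain \<Phi> where \<Phi>: "homeomorphic_map X Y \<Phi>" "\<And>g x. x \<in> topspace X \<Longrightarrow> \<Phi> (act g x) = act' g (\<Phi> x)"
    and G: "compact_G_space X act"
    using assms(1) unfolding isomorphic_compact_G_spaces_def by blast
  obtain \<Psi> where \<Psi>: "homeomorphic_map Y Z \<Psi>" "\<And>g y. y \<in> topspace Y \<Longrightarrow> \<Psi> (act' g y) = act'' g (\<Psi> y)"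
    using assms(2) unfolding isomorphic_compact_G_spaces_def by blast
  have "\<Phi> x \<in> topspace Y" if "x \<in> topspace X" for x
    using homeomorphic_imp_surjective_map[OF \<Phi>(1)] that by blast
  then show ?thesis
    using \<Phi>(2) \<Psi>(2) by (intro isomorphic_compact_G_spacesI[OF G homeomorphic_map_compose[OF \<Phi>(1) \<Psi>(1)]]) simp
qed

section \<open>Gelfand spaces of compactifications\<close>

lemma continuous_on_closure_range_unique:
  fixes F G :: "'k::topological_space \<Rightarrow> real"
  assumes "continuous_on (closure (range M)) F" "continuous_on (closure (range M)) G"
    and "\<And>g. F (M g) = G (M g)" and "p \<in> closure (range M)"
  shows "F p = G p"
proof -
  have "F p - G p = 0"
    by (rule continuous_constant_on_closure[where S = "range M"])
      (use assms in \<open>auto intro: continuous_on_diff\<close>)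
  then show ?thesis
    by simp
qed

text \<open>The choice is unique on the closure of the range by density; values elsewhere are
  unspecified, so extensions are compared on the closure only.\<close>

definition extension :: "('g::topological_space \<Rightarrow> 'k::topological_space) \<Rightarrow> ('g \<Rightarrow>\<^sub>C real) \<Rightarrow> 'k \<Rightarrow> real" where
  "extension M f = (SOME F. continuous_on (closure (range M)) F \<and> (\<forall>g. apply_bcontfun f g = F (M g)))"

definition extendable :: "('g::topological_space \<Rightarrow> 'k::topological_space) \<Rightarrow> ('g \<Rightarrow>\<^sub>C real) set" where
  "extendable M = {f. \<exists>F. continuous_on (closure (range M)) F \<and> (\<forall>g. apply_bcontfun f g = F (M g))}"

lemma extension:
  assumes "f \<in> extendable M"
  shows "continuous_on (closure (range M)) (extension M f)" "extension M f (M g) = apply_bcontfun f g"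
proof -
  have "continuous_on (closure (range M)) (extension M f) \<and> (\<forall>g. apply_bcontfun f g = extension M f (M g))"
    using assms unfolding extension_def extendable_def mem_Collect_eq by (rule someI_ex)
  then show "continuous_on (closure (range M)) (extension M f)" "extension M f (M g) = apply_bcontfun f g"
    by auto
qed

lemma extension_eq:
  assumes "continuous_on (closure (range M)) F" "\<And>g. apply_bcontfun f g = F (M g)"
    and "p \<in> closure (range M)"
  shows "extension M f p = F p"
proof -
  have f: "f \<in> extendable M"
    using assms by (auto simp: extendable_def)
  show ?thesis
    by (rule continuous_on_closure_range_unique[OF extension(1)[OF f] assms(1) _ assms(3)])
      (simp add: extension(2)[OF f] assms(2))
qed

text \<open>Every character is evaluation at a point of \<open>K\<close>. Otherwise compactness
  gives finitely many functions in its kernel without common zero; the sum of their squares is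
  invertible, yet the character kills it.\<close>

lemma gelfand_space_of_compactification:
  fixes M :: "'g::topological_space \<Rightarrow> 'k::t2_space"
  assumes K: "compact (closure (range M))" and M: "continuous_on UNIV M"
    and sep: "\<And>p q. p \<in> closure (range M) \<Longrightarrow> q \<in> closure (range M) \<Longrightarrow> p \<noteq> q \<Longrightarrow>
      \<exists>F. continuous_on (closure (range M)) F \<and> F p \<noteq> (F q :: real)"
  shows "homeomorphic_map (top_of_set (closure (range M))) (gelfand_space (extendable M))
    (\<lambda>p. \<lambda>f\<in>extendable M. extension M f p)"
proof -
  define K where "K = closure (range M)"
  define A where "A = extendable M"
  define ext where "ext = extension M"
  have cK: "compact K"
    using K by (simp add: K_def)
  have MK: "M g \<in> K" for g
    using closure_subset[of "range M"] by (auto simp: K_def)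
  \<comment> \<open>\<open>C\<close> restricts functions from \<open>K\<close> to the group. It is
    inverse to \<open>ext\<close>, so that the algebra operations of \<open>A\<close> can be
    computed on \<open>K\<close>.\<close>
  define C where "C F = Bcontfun (\<lambda>g. F (M g) :: real)" for F
  have C: "apply_bcontfun (C F) g = F (M g)" if "continuous_on K F" for F g
  proof -
    have "continuous_on UNIV (\<lambda>g. F (M g))"
      by (rule continuous_on_compose2[OF that M]) (use MK in auto)
    moreover have "bounded (F ` K)"
      by (intro compact_imp_bounded compact_continuous_image that cK)
    then have "bounded (range (\<lambda>g. F (M g)))"
      by (rule bounded_subset) (use MK in auto)
    ultimately show ?thesis
      by (simp add: C_def Bcontfun_inverse bcontfun_def)
  qed
  have CA: "C F \<in> A" if "continuous_on K F" for F
    using that C[OF that] unfolding A_def extendable_def K_def by blast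
  have ext_cont: "continuous_on K (ext f)" and ext_M: "ext f (M g) = apply_bcontfun f g"
    if "f \<in> A" for f g
    using extension[of f M] that by (simp_all add: A_def K_def ext_def)
  have ext_eq: "ext f p = F p"
    if "continuous_on K F" "\<And>g. apply_bcontfun f g = F (M g)" "p \<in> K" for f F p
    using extension_eq[of M F f p] that by (simp add: K_def ext_def)
  have ext_C: "ext (C F) p = F p" if "continuous_on K F" "p \<in> K" for F p
    by (rule ext_eq[OF that(1) C[OF that(1)] that(2)])
  have C_ext: "C (ext f) = f" if "f \<in> A" for f
    by (rule bcontfun_eqI) (simp add: C[OF ext_cont[OF that]] ext_M[OF that])
  have C_cong: "C F = C G" if "\<And>p. p \<in> K \<Longrightarrow> F p = G p" for F G
    using that MK by (simp add: C_def)
  have C_add: "C (\<lambda>p. F p + G p) = C F + C G" and C_times: "C (\<lambda>p. F p * G p) = bcontfun_times (C F) (C G)"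
    if "continuous_on K F" "continuous_on K G" for F G
    by (rule bcontfun_eqI, simp add: plus_bcontfun.rep_eq bcontfun_times.rep_eq C that
        continuous_on_add continuous_on_mult)+
  have C_scale: "C (\<lambda>p. c * F p) = c *\<^sub>R C F" if "continuous_on K F" for c F
    by (rule bcontfun_eqI) (simp add: scaleR_bcontfun.rep_eq C that continuous_on_mult_left)
  define \<Phi> where "\<Phi> p = (\<lambda>f\<in>A. ext f p)" for p
  have \<Phi>_char: "\<Phi> p \<in> characters A" if p: "p \<in> K" for p
    unfolding characters_def
  proof (intro CollectI conjI ballI allI)
    show "\<Phi> p \<in> extensional A"
      by (simp add: \<Phi>_def)
    fix f g
    assume f: "f \<in> A" and g: "g \<in> A"
    have fg: "C (\<lambda>p. ext f p + ext g p) = f + g" "C (\<lambda>p. ext f p * ext g p) = bcontfun_times f g"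
      using f g by (simp_all add: C_add C_times ext_cont C_ext)
    have "f + g \<in> A" "bcontfun_times f g \<in> A"
      unfolding fg[symmetric] by (intro CA continuous_intros ext_cont f g)+
    moreover have "ext (f + g) p = ext f p + ext g p" "ext (bcontfun_times f g) p = ext f p * ext g p"
      unfolding fg[symmetric] by (intro ext_C continuous_intros ext_cont f g p)+
    ultimately show "\<Phi> p (f + g) = \<Phi> p f + \<Phi> p g" "\<Phi> p (bcontfun_times f g) = \<Phi> p f * \<Phi> p g"
      using f g by (simp_all add: \<Phi>_def)
  next
    fix c :: real and f
    assume f: "f \<in> A"
    have cf: "C (\<lambda>p. c * ext f p) = c *\<^sub>R f"
      using f by (simp add: C_scale ext_cont C_ext)
    have "c *\<^sub>R f \<in> A"
      unfolding cf[symmetric] by (intro CA continuous_intros ext_cont f)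
    moreover have "ext (c *\<^sub>R f) p = c * ext f p"
      unfolding cf[symmetric] by (intro ext_C continuous_intros ext_cont f p)
    ultimately show "\<Phi> p (c *\<^sub>R f) = c * \<Phi> p f"
      using f by (simp add: \<Phi>_def)
  next
    have "\<Phi> p (C (\<lambda>_. 1)) = 1"
      using p by (simp add: \<Phi>_def CA ext_C)
    then show "\<exists>f\<in>A. \<Phi> p f \<noteq> 0"
      using CA[of "\<lambda>_. 1"] by (intro bexI[of _ "C (\<lambda>_. 1)"]) simp_all
  qed
  have topspace: "topspace (gelfand_space A) = characters A"
    by (auto simp: gelfand_space_def characters_def PiE_def)
  have surj: "\<exists>p\<in>K. \<phi> = \<Phi> p" if \<phi>: "\<phi> \<in> characters A" for \<phi>
  proof (rule ccontr)
    assume no: "\<not> (\<exists>p\<in>K. \<phi> = \<Phi> p)"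
    define \<psi> where "\<psi> F = \<phi> (C F)" for F
    have \<psi>_add: "\<psi> (\<lambda>p. F p + G p) = \<psi> F + \<psi> G" and \<psi>_mult: "\<psi> (\<lambda>p. F p * G p) = \<psi> F * \<psi> G"
      if "continuous_on K F" "continuous_on K G" for F G
      using \<phi> that by (simp_all add: \<psi>_def C_add C_times CA characters_def)
    have \<psi>_scale: "\<psi> (\<lambda>p. c * F p) = c * \<psi> F" if "continuous_on K F" for c F
      using \<phi> that by (simp add: \<psi>_def C_scale CA characters_def)
    have \<psi>_1: "\<psi> (\<lambda>_. 1) = 1"
    proof -
      obtain f where f: "f \<in> A" "\<phi> f \<noteq> 0"
        using \<phi> by (auto simp: characters_def)
      have "\<phi> f = \<psi> (\<lambda>p. ext f p * 1)"
        using f by (simp add: \<psi>_def C_ext)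
      also have "\<dots> = \<phi> f * \<psi> (\<lambda>_. 1)"
        by (subst \<psi>_mult) (use f in \<open>simp_all add: ext_cont \<psi>_def C_ext\<close>)
      finally show ?thesis
        using f(2) by simp
    qed
    have \<psi>_const: "\<psi> (\<lambda>_. c) = c" for c
      using \<psi>_scale[of "\<lambda>_. 1" c] \<psi>_1 by simp
    have "\<exists>f\<in>A. ext f p \<noteq> \<phi> f" if "p \<in> K" for p
    proof (rule ccontr)
      assume "\<not> (\<exists>f\<in>A. ext f p \<noteq> \<phi> f)"
      then have "\<phi> = \<Phi> p"
        using \<phi> by (intro extensionalityI[of _ A]) (auto simp: \<Phi>_def characters_def)
      with no that show False
        by blast
    qed
    then obtain f where f: "\<And>p. p \<in> K \<Longrightarrow> f p \<in> A \<and> ext (f p) p \<noteq> \<phi> (f p)"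
      by metis
    have "\<exists>U. open U \<and> p \<in> U \<and> (\<forall>q\<in>K. q \<in> U \<longrightarrow> ext (f p) q \<noteq> \<phi> (f p))" if p: "p \<in> K" for p
    proof -
      have "continuous_on K (ext (f p))"
        using f[OF p] ext_cont by blast
      moreover have "open (- {\<phi> (f p)})" "ext (f p) p \<in> - {\<phi> (f p)}"
        using f[OF p] by auto
      ultimately obtain U where "open U" "p \<in> U" "\<forall>q\<in>K. q \<in> U \<longrightarrow> ext (f p) q \<in> - {\<phi> (f p)}"
        using p unfolding continuous_on_topological by meson
      then show ?thesis
        by (intro exI[of _ U]) simp
    qed
    then obtain U where U: "\<And>p. p \<in> K \<Longrightarrow> open (U p) \<and> p \<in> U p \<and> (\<forall>q\<in>K. q \<in> U p \<longrightarrow> ext (f p) q \<noteq> \<phi> (f p))"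
      by metis
    have "\<And>p. p \<in> K \<Longrightarrow> open (U p)" "K \<subseteq> (\<Union>p\<in>K. U p)"
      using U by auto
    then obtain P where P: "P \<subseteq> K" "finite P" "K \<subseteq> (\<Union>p\<in>P. U p)"
      by (rule compactE_image[OF cK])
    define h where "h p q = ext (f p) q + - \<phi> (f p)" for p q
    \<comment> \<open>Each \<open>h p\<close> lies in the kernel of \<open>\<psi>\<close> and does
      not vanish on \<open>U p\<close>; squares cannot cancel, so \<open>H\<close> has no zero on
      \<open>K\<close>.\<close>
    define H where "H q = (\<Sum>p\<in>P. h p q * h p q)" for q
    have h_cont: "continuous_on K (h p)" and \<psi>_h: "\<psi> (h p) = 0" if "p \<in> P" for p
    proof -
      have fp: "f p \<in> A"
        using f P(1) that by blast
      show "continuous_on K (h p)"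
        unfolding h_def by (intro continuous_intros ext_cont fp)
      have "\<psi> (h p) = \<psi> (ext (f p)) + \<psi> (\<lambda>_. - \<phi> (f p))"
        unfolding h_def by (intro \<psi>_add ext_cont fp continuous_intros)
      then show "\<psi> (h p) = 0"
        unfolding \<psi>_const by (simp add: \<psi>_def C_ext fp)
    qed
    have H_cont: "continuous_on K H"
      unfolding H_def by (intro continuous_intros h_cont)
    have "\<psi> (\<lambda>q. \<Sum>p\<in>Q. h p q * h p q) = 0" if "Q \<subseteq> P" for Q
      using finite_subset[OF that P(2)] that
    proof induction
      case empty
      then show ?case
        by (simp add: \<psi>_const)
    next
      case (insert r Q)
      have Q: "continuous_on K (\<lambda>q. \<Sum>p\<in>Q. h p q * h p q)"
        using insert.prems by (intro continuous_intros h_cont) auto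
      have r: "continuous_on K (h r)" "\<psi> (h r) = 0"
        using insert.prems h_cont \<psi>_h by auto
      show ?case
        using insert by (simp add: \<psi>_add \<psi>_mult continuous_on_mult Q r)
    qed
    then have \<psi>_H: "\<psi> H = 0"
      by (simp add: H_def[abs_def])
    have H_ne: "H q \<noteq> 0" if q: "q \<in> K" for q
    proof -
      obtain p where p: "p \<in> P" "q \<in> U p"
        using P(3) q by blast
      then have "h p q \<noteq> 0"
        using U[of p] P(1) q by (auto simp: h_def)
      then have "0 < h p q * h p q"
        using not_real_square_gt_zero by blast
      also have "\<dots> \<le> H q"
        unfolding H_def by (rule member_le_sum[OF p(1) _ P(2)]) simp
      finally show ?thesis
        by simp
    qed
    \<comment> \<open>Outside \<open>K\<close> the function \<open>H\<close> may vanish and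
      \<open>inverse\<close> take its default value 0; by \<open>C_cong\<close> only values on
      \<open>K\<close> count.\<close>
    have "\<psi> (\<lambda>_. 1) = \<psi> (\<lambda>q. H q * inverse (H q))"
      unfolding \<psi>_def by (rule arg_cong[where f=\<phi>, OF C_cong]) (simp add: H_ne)
    also have "\<dots> = \<psi> H * \<psi> (\<lambda>q. inverse (H q))"
      by (rule \<psi>_mult[OF H_cont continuous_on_inverse[OF H_cont]]) (simp add: H_ne)
    finally show False
      using \<psi>_H \<psi>_1 by simp
  qed
  have "homeomorphic_map (top_of_set K) (gelfand_space A) \<Phi>"
  proof (rule continuous_imp_homeomorphic_map)
    show "compact_space (top_of_set K)"
      using cK by (simp add: compact_space_subtopology)
    show "Hausdorff_space (gelfand_space A)"
      unfolding gelfand_space_def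
      by (intro Hausdorff_space_subtopology) (simp add: Hausdorff_space_product_topology)
    show "\<Phi> ` topspace (top_of_set K) = topspace (gelfand_space A)"
      using \<Phi>_char surj unfolding topspace by auto
    show "inj_on \<Phi> (topspace (top_of_set K))"
    proof (rule inj_onI, rule ccontr)
      fix p q
      assume "p \<in> topspace (top_of_set K)" "q \<in> topspace (top_of_set K)" and eq: "\<Phi> p = \<Phi> q" and "p \<noteq> q"
      then obtain F :: "'k \<Rightarrow> real" where F: "continuous_on K F" "F p \<noteq> F q" and pq: "p \<in> K" "q \<in> K"
        using sep[of p q] by (auto simp: K_def)
      then show False
        using fun_cong[OF eq, of "C F"] by (simp add: \<Phi>_def CA ext_C)
    qed
    show "continuous_map (top_of_set K) (gelfand_space A) \<Phi>"
      unfolding gelfand_space_def continuous_map_in_subtopology continuous_map_componentwise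
    proof (intro conjI ballI)
      show "\<Phi> \<in> topspace (top_of_set K) \<rightarrow> characters A"
        using \<Phi>_char by auto
      show "continuous_map (top_of_set K) euclideanreal (\<lambda>p. \<Phi> p f)" if "f \<in> A" for f
        using that ext_cont[OF that] by (simp add: \<Phi>_def)
    qed (auto simp: \<Phi>_def)
  qed
  then show ?thesis
    unfolding \<Phi>_def A_def K_def ext_def .
qed

section \<open>The compactification of \<open>S(\<nat>)\<close> by 0-1 matrices\<close>

lemma UC_eq_extendable: "(UC :: (nat_perm \<Rightarrow>\<^sub>C real) set) = extendable perm_matrix"
  using UC_iff_extension by (auto simp: extendable_def matrix_closure_def)

definition matrix_action :: "nat_perm \<Rightarrow> (nat \<times> nat \<Rightarrow> bool) \<Rightarrow> nat \<times> nat \<Rightarrow> bool" where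
  "matrix_action g = matrix_permute 0 (- g)"

lemma matrix_action_apply [simp]: "matrix_action g p (i, j) = p (i, perm_apply (- g) j)"
  by (simp add: matrix_action_def)

lemma matrix_action_perm_matrix: "matrix_action g (perm_matrix h) = perm_matrix (g + h)"
  by (simp add: matrix_action_def matrix_permute_perm_matrix)

lemma matrix_action_in_closure: "p \<in> matrix_closure \<Longrightarrow> matrix_action g p \<in> matrix_closure"
  by (simp add: matrix_action_def matrix_permute_in_closure)

text \<open>Joint continuity holds since one entry of the result depends, locally, on one value of
  \<open>- g\<close> and one entry of \<open>p\<close>.\<close>

lemma continuous_on_matrix_action: "continuous_on S (\<lambda>(g, p). matrix_action g p)"
proof (rule continuous_on_coordinatewise_then_product)
  fix x :: "nat \<times> nat"
  obtain i j where x: "x = (i, j)"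
    by fastforce
  show "continuous_on S (\<lambda>z. (case z of (g, p) \<Rightarrow> matrix_action g p) x)"
    unfolding continuous_on_topological
  proof (intro ballI allI impI)
    fix z B
    assume B: "(case z of (g, p) \<Rightarrow> matrix_action g p) x \<in> B"
    obtain g p where z: "z = (g, p)"
      by fastforce
    define m where "m = perm_apply (- g) j"
    let ?A = "((\<lambda>h. perm_apply (- h) j) -` {m}) \<times> ((\<lambda>q. q (i, m)) -` {p (i, m)})"
    have "open ?A"
      by (intro open_Times open_vimage open_discrete continuous_on_perm_apply_uminus
          continuous_on_product_coordinates)
    moreover have "z \<in> ?A"
      by (simp add: z m_def)
    moreover have "(case w of (g, p) \<Rightarrow> matrix_action g p) x \<in> B" if "w \<in> ?A" for w
      using that B by (auto simp: x z m_def split_beta)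
    ultimately show "\<exists>A. open A \<and> z \<in> A \<and>
        (\<forall>w\<in>S. w \<in> A \<longrightarrow> (case w of (g, p) \<Rightarrow> matrix_action g p) x \<in> B)"
      by blast
  qed
qed

lemma compact_G_space_matrix_closure: "compact_G_space (top_of_set matrix_closure) matrix_action"
  unfolding compact_G_space_def
proof (intro conjI ballI allI)
  show "compact_space (top_of_set matrix_closure)"
    using compact_matrix_closure by (simp add: compact_space_subtopology)
  show "Hausdorff_space (top_of_set matrix_closure)"
    by (intro Hausdorff_space_subtopology Hausdorff_space_euclidean_t2)
  have "prod_topology (euclidean :: nat_perm topology) (top_of_set matrix_closure) =
      top_of_set (UNIV \<times> matrix_closure)"
    using prod_topology_subtopology_eu[of "UNIV :: nat_perm set" matrix_closure] by simp
  then show "continuous_map (prod_topology euclidean (top_of_set matrix_closure)) (top_of_set matrix_closure)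
      (\<lambda>(g, p). matrix_action g p)"
    using matrix_action_in_closure
    by (auto simp: continuous_map_in_subtopology continuous_on_matrix_action)
  show "matrix_action 0 p = p" for p
    by (auto simp: fun_eq_iff)
  show "matrix_action (g + h) p = matrix_action g (matrix_action h p)" for g h p
    by (auto simp: fun_eq_iff minus_add)
qed

text \<open>For equivariance, composing the extension of \<open>f\<close> with the action of
  \<open>g\<close> gives a continuous extension of \<open>translate f g\<close>; extensions are
  unique on the closure.\<close>

lemma isomorphic_matrix_closure_gelfand:
  "isomorphic_compact_G_spaces (top_of_set matrix_closure) matrix_action
    (gelfand_space UC) (gelfand_action UC)"
proof (rule isomorphic_compact_G_spacesI[OF compact_G_space_matrix_closure])
  let ?\<Phi> = "\<lambda>p. \<lambda>f\<in>UC. extension perm_matrix f p"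
  show "homeomorphic_map (top_of_set matrix_closure) (gelfand_space UC) ?\<Phi>"
    unfolding UC_eq_extendable matrix_closure_def
  proof (rule gelfand_space_of_compactification)
    show "compact (closure (range perm_matrix))"
      using compact_matrix_closure by (simp add: matrix_closure_def)
    show "continuous_on UNIV perm_matrix"
      by (rule continuous_on_perm_matrix)
    fix p q :: "nat \<times> nat \<Rightarrow> bool"
    assume "p \<noteq> q"
    then obtain i where "p i \<noteq> q i"
      by (auto simp: fun_eq_iff)
    then show "\<exists>F. continuous_on (closure (range perm_matrix)) F \<and> F p \<noteq> (F q :: real)"
      by (intro exI[of _ "\<lambda>p. of_bool (\<forall>i\<in>{i}. p i)"] conjI continuous_on_monomial) auto
  qed
  fix g p
  assume "p \<in> topspace (top_of_set matrix_closure)"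
  then have p: "p \<in> matrix_closure"
    by simp
  have "translate f g \<in> UC \<and> extension perm_matrix f (matrix_action g p) = extension perm_matrix (translate f g) p"
    if f: "f \<in> UC" for f
  proof -
    have fe: "f \<in> extendable perm_matrix"
      using f by (simp add: UC_eq_extendable)
    define F where "F = extension perm_matrix f"
    have F: "continuous_on matrix_closure F" "\<And>h. apply_bcontfun f h = F (perm_matrix h)"
      using extension[OF fe] by (simp_all add: F_def matrix_closure_def)
    have "continuous_on matrix_closure (\<lambda>p. (g, p))"
      by (intro continuous_intros)
    from continuous_on_compose2[OF continuous_on_matrix_action[of UNIV] this]
    have "continuous_on matrix_closure (matrix_action g)"
      by simp
    then have "continuous_on matrix_closure (\<lambda>p. F (matrix_action g p))"
      by (rule continuous_on_compose2[OF F(1)]) (use matrix_action_in_closure in auto)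
    moreover have "apply_bcontfun (translate f g) h = F (matrix_action g (perm_matrix h))" for h
      by (simp add: translate.rep_eq F(2) matrix_action_perm_matrix)
    ultimately have "extension perm_matrix (translate f g) p = F (matrix_action g p)" "translate f g \<in> UC"
      using p extension_eq[of perm_matrix "\<lambda>p. F (matrix_action g p)" "translate f g" p]
      by (auto simp: matrix_closure_def UC_iff_extension)
    then show ?thesis
      by (simp add: F_def)
  qed
  then show "?\<Phi> (matrix_action g p) = gelfand_action UC g (?\<Phi> p)"
    by (auto simp: gelfand_action_def)
qed

section \<open>The enveloping semigroup as a space of matrices\<close>

lemma topspace_X_star [simp]: "topspace X_star = UNIV"
  by (auto simp: X_star_def UNIV_option_conv)

lemma compact_space_X_star: "compact_space X_star"
  by (simp add: X_star_def)

lemma Hausdorff_space_X_star: "Hausdorff_space X_star"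
  by (simp add: X_star_def Hausdorff_space_Alexandroff_compactification
      locally_compact_space_discrete_topology)

text \<open>The isolated point \<open>Some j\<close> forms a clopen set. This makes each matrix
  entry a continuous function on the enveloping semigroup.\<close>

lemma continuous_map_X_star_eq_Some: "continuous_map X_star euclidean (\<lambda>x. x = Some j)"
proof -
  have "openin X_star {Some j}"
    using openin_Alexandroff_compactification_image_Some[of "discrete_topology UNIV" "{j}"]
    by (simp add: X_star_def)
  moreover have "closedin X_star {Some j}"
    using Hausdorff_imp_t1_space[OF Hausdorff_space_X_star] by (simp add: t1_space_closedin_singleton)
  then have "openin X_star (- {Some j})"
    by (simp add: closedin_def Compl_eq_Diff_UNIV)
  moreover have "{x. (x = Some j) \<in> U} = (if True \<in> U then {Some j} else {}) \<union> (if False \<in> U then - {Some j} else {})"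
    for U
  proof (rule set_eqI)
    show "x \<in> {x. (x = Some j) \<in> U} \<longleftrightarrow>
        x \<in> (if True \<in> U then {Some j} else {}) \<union> (if False \<in> U then - {Some j} else {})" for x
      by (cases "x = Some j") auto
  qed
  moreover have "openin X_star UNIV"
    using openin_topspace[of X_star] by simp
  ultimately show ?thesis
    by (auto simp: continuous_map_def)
qed

text \<open>Row \<open>i\<close> is zero exactly if \<open>p (Some i)\<close> is the point at
  infinity. The value at \<open>None\<close> is not recorded; all elements of the enveloping
  semigroup fix \<open>None\<close>.\<close>

definition enveloping_matrix :: "(nat option \<Rightarrow> nat option) \<Rightarrow> nat \<times> nat \<Rightarrow> bool" where
  "enveloping_matrix p = (\<lambda>(i, j). p (Some i) = Some j)"

lemma enveloping_matrix_inject: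
  assumes eq: "enveloping_matrix p = enveloping_matrix q" and None: "p None = None" "q None = None"
  shows "p = q"
proof
  fix x
  have "p (Some i) = Some j \<longleftrightarrow> q (Some i) = Some j" for i j
    using fun_cong[OF eq, of "(i, j)"] by (simp add: enveloping_matrix_def)
  then have "p (Some i) = q (Some i)" for i
    by (metis not_Some_eq)
  then show "p x = q x"
    using None by (cases x) simp_all
qed

text \<open>By compactness the map carries the closure of the translations onto the closure of their
  matrices. It is injective there because fixing \<open>None\<close> is a closed condition shared by
  all translations.\<close>

lemma
  shows homeomorphic_map_enveloping_matrix:
    "homeomorphic_map (enveloping_semigroup X_star X_star_action) (top_of_set matrix_closure) enveloping_matrix"
  and enveloping_semigroup_X_star_None:
    "\<And>p. p \<in> topspace (enveloping_semigroup X_star X_star_action) \<Longrightarrow> p None = None"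
proof -
  define P where "P = product_topology (\<lambda>_ :: nat option. X_star) UNIV"
  define S where "S = range X_star_action"
  define E where "E = P closure_of S"
  have "restrict (X_star_action g) UNIV = X_star_action g" for g
    by (simp add: restrict_def)
  then have env: "enveloping_semigroup X_star X_star_action = subtopology P E"
    by (simp add: enveloping_semigroup_def P_def E_def S_def Let_def)
  have topP [simp]: "topspace P = UNIV"
    by (simp add: P_def)
  have P: "compact_space P" "Hausdorff_space P"
    by (simp_all add: P_def compact_space_product_topology Hausdorff_space_product_topology
        compact_space_X_star Hausdorff_space_X_star)
  have E: "closedin P E"
    by (simp add: E_def)
  have \<Theta>: "continuous_map P euclidean enveloping_matrix"
    unfolding euclidean_product_topology[symmetric] continuous_map_componentwise_UNIV
  proof
    fix x :: "nat \<times> nat"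
    have "continuous_map P X_star (\<lambda>p. p (Some (fst x)))"
      unfolding P_def by (rule continuous_map_product_projection) simp
    from continuous_map_compose[OF this continuous_map_X_star_eq_Some[of "snd x"]]
    show "continuous_map P euclidean (\<lambda>p. enveloping_matrix p x)"
      by (simp add: enveloping_matrix_def split_beta o_def)
  qed
  have \<Theta>S: "enveloping_matrix ` S = range perm_matrix"
    by (auto simp: S_def image_image enveloping_matrix_def X_star_action_def perm_matrix_def)
  have cE: "compactin P E"
    by (rule closedin_compact_space[OF P(1) E])
  have image: "enveloping_matrix ` E = matrix_closure"
  proof
    show "enveloping_matrix ` E \<subseteq> matrix_closure"
      using continuous_map_image_closure_subset[OF \<Theta>, of S] by (simp add: E_def \<Theta>S matrix_closure_def)
    have "compact (enveloping_matrix ` E)"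
      using image_compactin[OF cE \<Theta>] by simp
    moreover have "S \<subseteq> E"
      by (simp add: E_def closure_of_subset)
    ultimately show "matrix_closure \<subseteq> enveloping_matrix ` E"
      unfolding matrix_closure_def \<Theta>S[symmetric] by (intro closure_minimal image_mono compact_imp_closed)
  qed
  show None: "p None = None" if "p \<in> topspace (enveloping_semigroup X_star X_star_action)" for p
  proof -
    have "continuous_map P X_star (\<lambda>p. p None)"
      unfolding P_def by (rule continuous_map_product_projection) simp
    moreover have "closedin X_star {None}"
      using Hausdorff_imp_t1_space[OF Hausdorff_space_X_star] by (simp add: t1_space_closedin_singleton)
    ultimately have "closedin P {p \<in> topspace P. p None \<in> {None}}"
      by (rule closedin_continuous_map_preimage)
    then have "E \<subseteq> {p \<in> topspace P. p None \<in> {None}}"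
      unfolding E_def by (rule closure_of_minimal[rotated]) (auto simp: S_def X_star_action_def)
    then show ?thesis
      using that by (auto simp: env)
  qed
  have inj: "inj_on enveloping_matrix E"
    by (rule inj_onI) (auto intro: enveloping_matrix_inject simp: None env)
  show "homeomorphic_map (enveloping_semigroup X_star X_star_action) (top_of_set matrix_closure)
      enveloping_matrix"
    unfolding env
  proof (rule continuous_imp_homeomorphic_map)
    show "continuous_map (subtopology P E) (top_of_set matrix_closure) enveloping_matrix"
      unfolding continuous_map_in_subtopology
      using image by (auto intro: continuous_map_from_subtopology[OF \<Theta>])
    show "compact_space (subtopology P E)"
      using cE by (simp add: compact_space_subtopology)
    show "Hausdorff_space (top_of_set matrix_closure)"
      by (intro Hausdorff_space_subtopology Hausdorff_space_euclidean_t2)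
  qed (use image inj in simp_all)
qed

lemma enveloping_matrix_action:
  "enveloping_matrix (enveloping_action X_star X_star_action g p) = matrix_action g (enveloping_matrix p)"
  by (rule ext) (auto simp: enveloping_matrix_def enveloping_action_def X_star_action_def
      matrix_action_def matrix_permute_def)

lemma isomorphic_matrix_closure_enveloping:
  "isomorphic_compact_G_spaces (top_of_set matrix_closure) matrix_action
    (enveloping_semigroup X_star X_star_action) (enveloping_action X_star X_star_action)"
proof -
  let ?E = "enveloping_semigroup X_star X_star_action"
  obtain \<Psi> where m: "homeomorphic_maps ?E (top_of_set matrix_closure) enveloping_matrix \<Psi>"
    using homeomorphic_map_enveloping_matrix by (auto simp: homeomorphic_map_maps)
  have \<Psi>: "\<Psi> p \<in> topspace ?E" "enveloping_matrix (\<Psi> p) = p" if "p \<in> matrix_closure" for p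
    using m that by (auto simp: homeomorphic_maps_def continuous_map_def)
  show ?thesis
  proof (rule isomorphic_compact_G_spacesI[OF compact_G_space_matrix_closure])
    show "homeomorphic_map (top_of_set matrix_closure) ?E \<Psi>"
      using m homeomorphic_maps_sym unfolding homeomorphic_map_maps by blast
    fix g p
    assume "p \<in> topspace (top_of_set matrix_closure)"
    then have p: "p \<in> matrix_closure"
      by simp
    have "enveloping_action X_star X_star_action g (\<Psi> p) None = None"
      using enveloping_semigroup_X_star_None[OF \<Psi>(1)[OF p]]
      by (simp add: enveloping_action_def X_star_action_def)
    then show "\<Psi> (matrix_action g p) = enveloping_action X_star X_star_action g (\<Psi> p)"
      using \<Psi> p matrix_action_in_closure[OF p]
      by (intro enveloping_matrix_inject) (simp_all add: enveloping_matrix_action enveloping_semigroup_X_star_None)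
  qed
qed

text \<open>The finite set \<open>I\<close> involves only rows below some \<open>N\<close>. A
  permutation \<open>g\<close> approximating \<open>p\<close> can be changed at \<open>N\<close>
  without affecting these rows, and at most one of the two resulting matrices equals
  \<open>p\<close>.\<close>

lemma matrix_closure_perfect:
  assumes p: "p \<in> matrix_closure" and I: "finite I"
  obtains q where "q \<in> matrix_closure" "q \<noteq> p" "\<And>i. i \<in> I \<Longrightarrow> q i = p i"
proof -
  obtain g where g: "\<And>i. i \<in> I \<Longrightarrow> perm_matrix g i = p i"
    using matrix_closure_approx[OF p I] by blast
  have "finite (fst ` I)"
    using I by simp
  then obtain N where N: "fst ` I \<subseteq> {..<N}"
    using finite_nat_iff_bounded by blast
  obtain m where m: "m \<notin> perm_apply g ` {..N}"
    using ex_new_if_finite[of "perm_apply g ` {..N}"] infinite_UNIV_nat by blast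
  have "inj_on (\<lambda>i. if i < N then perm_apply g i else m) {..N}"
    using m by (auto simp: inj_on_def)
  then obtain h where h: "\<And>i. i \<in> {..N} \<Longrightarrow> perm_apply h i = (if i < N then perm_apply g i else m)"
    using ex_nat_perm_extending[of "{..N}"] by blast
  have eq: "perm_matrix h i = p i" if "i \<in> I" for i
  proof -
    have "fst i < N"
      using N that by auto
    then have "perm_matrix h i = perm_matrix g i"
      using h[of "fst i"] by (simp add: perm_matrix_def split_beta)
    then show ?thesis
      using g[OF that] by simp
  qed
  have "perm_apply h N = m" "perm_apply g N \<noteq> m"
    using h[of N] m by (simp, force)
  then have "perm_matrix h \<noteq> perm_matrix g"
    by (metis perm_matrix_apply)
  then have "perm_matrix h \<noteq> p \<or> perm_matrix g \<noteq> p"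
    by auto
  then show thesis
  proof
    assume "perm_matrix h \<noteq> p"
    then show thesis
      using eq by (intro that[of "perm_matrix h"]) simp_all
  next
    assume "perm_matrix g \<noteq> p"
    then show thesis
      using g by (intro that[of "perm_matrix g"]) simp_all
  qed
qed

lemma matrix_closure_homeomorphic_cantor_set: "matrix_closure homeomorphic cantor_set"
proof -
  \<comment> \<open>Enumerating the pairs turns matrices into sequences, to which the
    characterisation of perfect closed sets applies.\<close>
  define r where "r p = (\<lambda>n. p (prod_decode n))" for p :: "nat \<times> nat \<Rightarrow> bool"
  have r_cont: "continuous_on matrix_closure r"
    unfolding r_def by (intro continuous_on_coordinatewise_then_product
        continuous_on_subset[OF continuous_on_product_coordinates subset_UNIV])
  have r_inj: "inj r"
  proof (rule injI, rule ext)
    show "p x = q x" if "r p = r q" for p q x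
      using fun_cong[OF that, of "prod_encode x"] by (simp add: r_def)
  qed
  have "matrix_closure homeomorphic r ` matrix_closure"
    by (rule homeomorphic_compact[OF compact_matrix_closure r_cont refl])
      (use r_inj in \<open>auto intro: inj_on_subset\<close>)
  also have "r ` matrix_closure homeomorphic (UNIV :: (nat \<Rightarrow> bool) set)"
  proof (rule perfect_homeomorphic_Cantor_space)
    show "closed (r ` matrix_closure)"
      by (intro compact_imp_closed compact_continuous_image r_cont compact_matrix_closure)
    show "r ` matrix_closure \<noteq> {}"
      using perm_matrix_in_closure[of 0] by blast
    fix x n
    assume "x \<in> r ` matrix_closure"
    then obtain p where p: "p \<in> matrix_closure" "x = r p"
      by blast
    obtain q where q: "q \<in> matrix_closure" "q \<noteq> p" "\<And>i. i \<in> prod_decode ` {..<n} \<Longrightarrow> q i = p i"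
      using matrix_closure_perfect[OF p(1), of "prod_decode ` {..<n}"] by blast
    have "r q \<noteq> r p"
      using r_inj q(2) by (simp add: inj_eq)
    then show "\<exists>y\<in>r ` matrix_closure. (\<forall>i<n. y i = x i) \<and> y \<noteq> x"
      using q p(2) by (intro bexI[of _ "r q"]) (auto simp: r_def)
  qed
  also note Cantor_space_homeomorphic_cantor_set
  finally show ?thesis .
qed

theorem theorem12p2:
  shows "(UC :: (nat_perm \<Rightarrow>\<^sub>C real) set) = WAP
    \<and> isomorphic_compact_G_spaces
        (gelfand_space (WAP :: (nat_perm \<Rightarrow>\<^sub>C real) set)) (gelfand_action WAP)
        (enveloping_semigroup X_star X_star_action) (enveloping_action X_star X_star_action)
    \<and> isomorphic_compact_G_spaces
        (gelfand_space (UC :: (nat_perm \<Rightarrow>\<^sub>C real) set)) (gelfand_action UC)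
        (enveloping_semigroup X_star X_star_action) (enveloping_action X_star X_star_action)
    \<and> gelfand_space (WAP :: (nat_perm \<Rightarrow>\<^sub>C real) set) homeomorphic_space top_of_set cantor_set
    \<and> gelfand_space (UC :: (nat_perm \<Rightarrow>\<^sub>C real) set) homeomorphic_space top_of_set cantor_set"
proof -
  have iso: "isomorphic_compact_G_spaces
        (gelfand_space (UC :: (nat_perm \<Rightarrow>\<^sub>C real) set)) (gelfand_action UC)
        (enveloping_semigroup X_star X_star_action) (enveloping_action X_star X_star_action)"
    by (rule isomorphic_compact_G_spaces_trans
        [OF isomorphic_compact_G_spaces_sym[OF isomorphic_matrix_closure_gelfand]
          isomorphic_matrix_closure_enveloping])
  have "top_of_set matrix_closure homeomorphic_space gelfand_space (UC :: (nat_perm \<Rightarrow>\<^sub>C real) set)"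
    using isomorphic_matrix_closure_gelfand homeomorphic_map_imp_homeomorphic_space
    unfolding isomorphic_compact_G_spaces_def by blast
  moreover have "top_of_set matrix_closure homeomorphic_space top_of_set cantor_set"
    using matrix_closure_homeomorphic_cantor_set
    unfolding homeomorphic_def homeomorphic_space_def homeomorphic_maps_def homeomorphism_def
    by (force simp: continuous_map_in_subtopology)
  ultimately have "gelfand_space (UC :: (nat_perm \<Rightarrow>\<^sub>C real) set) homeomorphic_space top_of_set cantor_set"
    using homeomorphic_space_sym homeomorphic_space_trans by blast
  with iso show ?thesis
    unfolding UC_eq_WAP_nat_perm by blast
qed

end
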